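(* Let $n\ge 2$ be an integer, let $J=[a,b]$ and let $f:J\to\mathbb R$ be continuously differentiable with $c_5:=\sup_{x\in J}|f'(x)|<\infty$ and $\#\{x: f(x)=x\}<\infty$. Let $0<\lambda<\tfrac34$, let $c_3>0$ be a sufficiently large constant, and for $Q>0$ set $$L_J(Q,\lambda)=\Big\{(x_1,x_2)\in\mathbb R^2:\ |x_2-f(x_1)|<\big(\tfrac12+c_5\big)c_3Q^{-\lambda},\ x_1\in J\Big\}.$$ Then there exists $c_6=c_6(J,f,n)>0$ such that $$\#\big(\mathcal A_n^2(Q)\cap L_J(Q,\lambda)\big)\ge c_6\,Q^{n+1-\lambda}$$ for all $Q>Q_0(J,f,n,\lambda)$.
   Context: For $Q>0$, $\mathcal P_n(Q)$ denotes the set of polynomials $P\in\mathbb Z[t]$ with $\deg P\le n$ and height $H(P)=\max_j|a_j|\le Q$. A point $\boldsymbol\alpha=(\alpha_1,\alpha_2)\in\mathbb R^2$ is an algebraic point if $\alpha_1,\alpha_2$ are roots of a common polynomial in $\mathbb Z[t]$; its minimal polynomial is the polynomial of smallest degree in $\mathbb Z[t]$ vanishing at $\alpha_1$ and $\alpha_2$ with coprime coefficients, and the degree and height of $\boldsymbol\alpha$ are those of its minimal polynomial. $\mathcal A_n^2(Q)$ is the set of algebraic points of degree at most $n$ and height at most $Q$. *)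

theory Defs
  imports "HOL-Analysis.Analysis" "HOL-Computational_Algebra.Computational_Algebra"
begin

definition vanishes_at :: "int poly \<Rightarrow> real \<times> real \<Rightarrow> bool" where
  "vanishes_at P \<alpha> \<longleftrightarrow>
     poly (map_poly of_int P) (fst \<alpha>) = 0 \<and> poly (map_poly of_int P) (snd \<alpha>) = 0"

definition poly_height :: "int poly \<Rightarrow> int" where
  "poly_height P = Max ((\<lambda>j. \<bar>coeff P j\<bar>) ` {..degree P})"

definition algebraic_point :: "real \<times> real \<Rightarrow> bool" where
  "algebraic_point \<alpha> \<longleftrightarrow> (\<exists>P. P \<noteq> 0 \<and> vanishes_at P \<alpha>)"

(* P need not be irreducible: the coordinates may have different minimal polynomials. *)
definition is_minimal_poly :: "int poly \<Rightarrow> real \<times> real \<Rightarrow> bool" where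
  "is_minimal_poly P \<alpha> \<longleftrightarrow>
     P \<noteq> 0 \<and> vanishes_at P \<alpha> \<and> content P = 1 \<and>
     (\<forall>R. R \<noteq> 0 \<and> vanishes_at R \<alpha> \<longrightarrow> degree P \<le> degree R)"

(* The choice is only between P and - P, see minimal_poly_unique and minimal_poly_exists below. *)
definition minimal_poly :: "real \<times> real \<Rightarrow> int poly" where
  "minimal_poly \<alpha> = (SOME P. is_minimal_poly P \<alpha>)"

definition point_degree :: "real \<times> real \<Rightarrow> nat" where
  "point_degree \<alpha> = degree (minimal_poly \<alpha>)"

definition point_height :: "real \<times> real \<Rightarrow> int" where
  "point_height \<alpha> = poly_height (minimal_poly \<alpha>)"

definition algebraic_points :: "nat \<Rightarrow> real \<Rightarrow> (real \<times> real) set" where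
  "algebraic_points n Q =
     {\<alpha>. algebraic_point \<alpha> \<and> point_degree \<alpha> \<le> n \<and> of_int (point_height \<alpha>) \<le> Q}"

definition strip ::
  "real set \<Rightarrow> (real \<Rightarrow> real) \<Rightarrow> real \<Rightarrow> real \<Rightarrow> real \<Rightarrow> real \<Rightarrow> (real \<times> real) set" where
  "strip J f c5 c3 Q l =
     {(x1, x2). \<bar>x2 - f x1\<bar> < (1/2 + c5) * c3 * Q powr (- l) \<and> x1 \<in> J}"

lemma vanishes_at_smult_diff:
  assumes "vanishes_at P \<alpha>" "vanishes_at R \<alpha>"
  shows "vanishes_at (smult k P - smult m R) \<alpha>"
proof -
  have "map_poly of_int (smult k P - smult m R) =
      smult (of_int k) (map_poly of_int P) - smult (of_int m) (map_poly of_int R :: real poly)"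
    by (rule poly_eqI) (simp add: coeff_map_poly)
  thus ?thesis using assms by (simp add: vanishes_at_def)
qed

lemma minimal_poly_unique:
  assumes P: "is_minimal_poly P \<alpha>" and M: "is_minimal_poly M \<alpha>"
  shows "P = M \<or> P = - M"
proof -
  have deg: "degree P = degree M"
    using P M unfolding is_minimal_poly_def by (meson antisym)
  define R where "R = smult (lead_coeff M) P - smult (lead_coeff P) M"
  have "vanishes_at R \<alpha>"
    using P M unfolding R_def is_minimal_poly_def by (blast intro: vanishes_at_smult_diff)
  moreover have "coeff R (degree P) = 0" "degree R \<le> degree P"
    using deg by (auto simp: R_def mult.commute intro!: degree_diff_le)
  ultimately have "R = 0"
    using P unfolding is_minimal_poly_def by (metis antisym leading_coeff_0_iff)
  hence eq: "smult (lead_coeff M) P = smult (lead_coeff P) M"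
    by (simp add: R_def)
  hence "content (smult (lead_coeff M) P) = content (smult (lead_coeff P) M)"
    by simp
  hence "\<bar>lead_coeff M\<bar> = \<bar>lead_coeff P\<bar>"
    using P M by (simp add: is_minimal_poly_def)
  hence "lead_coeff P = lead_coeff M \<or> lead_coeff P = - lead_coeff M"
    by linarith
  moreover have "lead_coeff M \<noteq> 0"
    using M by (simp add: is_minimal_poly_def)
  moreover have "P = - M" if "lead_coeff P = - lead_coeff M"
  proof -
    have "smult (lead_coeff M) P = smult (lead_coeff M) (- M)"
      using eq that by simp
    thus ?thesis using \<open>lead_coeff M \<noteq> 0\<close> by (metis smult_cancel)
  qed
  ultimately show ?thesis using eq by (metis smult_cancel)
qed

lemma minimal_poly_exists:
  assumes "algebraic_point \<alpha>"
  shows "is_minimal_poly (minimal_poly \<alpha>) \<alpha>"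
proof -
  let ?S = "\<lambda>P. P \<noteq> 0 \<and> vanishes_at P \<alpha>"
  obtain P where P: "?S P" and min: "\<And>R. ?S R \<Longrightarrow> degree P \<le> degree R"
    using assms ex_has_least_nat[of ?S _ degree] unfolding algebraic_point_def by blast
  have "map_poly of_int P =
      smult (of_int (content P)) (map_poly of_int (primitive_part P) :: real poly)"
  proof (rule poly_eqI)
    fix j
    have "coeff P j = content P * coeff (primitive_part P) j"
      by (metis coeff_smult content_times_primitive_part)
    thus "coeff (map_poly of_int P) j =
        coeff (smult (of_int (content P)) (map_poly of_int (primitive_part P)) :: real poly) j"
      by (simp add: coeff_map_poly flip: of_int_mult)
  qed
  hence "vanishes_at (primitive_part P) \<alpha>"
    using P by (auto simp: vanishes_at_def)
  hence "is_minimal_poly (primitive_part P) \<alpha>"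
    using P min by (auto simp: is_minimal_poly_def)
  thus ?thesis unfolding minimal_poly_def by (rule someI)
qed

end

theory Submission
  imports Defs "HOL-Real_Asymp.Real_Asymp"
begin

text \<open>
  Place about \<open>Q\<^sup>\<lambda>\<close> disjoint boxes of radius \<open>r = Q\<^sup>-\<^sup>\<lambda>\<close> around points \<open>(x, f x)\<close> of the graph that
  stay away from the diagonal. For each box choose the coefficients \<open>a\<^sub>2, \<dots>, a\<^sub>n\<close> of size comparable
  to \<open>Q\<close>; there are unique real \<open>a\<^sub>0, a\<^sub>1\<close> for which the polynomial vanishes at \<open>x\<close> and \<open>f x\<close>. Its
  derivative there has size comparable to \<open>Q\<close>, so \<open>a\<^sub>0\<close> and \<open>a\<^sub>1\<close> may be moved by a small multiple
  of \<open>Q r\<close> without the two zeros leaving the box. As \<open>\<lambda> < 1\<close>, this leaves of the order of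
  \<open>(Q r)\<^sup>2\<close> integral choices, hence \<open>Q\<^sup>\<lambda> Q\<^sup>n\<^sup>-\<^sup>1 (Q r)\<^sup>2 = Q\<^sup>n\<^sup>+\<^sup>1\<^sup>-\<^sup>\<lambda>\<close> polynomials in total.

  To see that different polynomials give different points, only polynomials satisfying Eisenstein's
  criterion at 2 are used, and those with nontrivial content are discarded: an odd prime \<open>p\<close> dividing
  \<open>a\<^sub>n\<close> removes at most a proportion of about \<open>1 / p\<^sup>2\<close> of the pairs \<open>(a\<^sub>0, a\<^sub>1)\<close>, and these
  proportions sum to at most one half. The remaining polynomials are minimal polynomials of their
  points.
\<close>

section \<open>Eisenstein's criterion\<close>

text \<open>Exactly one factor has its constant coefficient divisible by \<open>p\<close>. In that
  factor let \<open>k\<close> be the least index of a coefficient not divisible by \<open>p\<close>.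
  Then \<open>p\<close> does not divide coefficient \<open>k\<close> of the product, so
  \<open>k\<close> is the full degree and the other factor is constant. Nontrivial constant factors
  remain possible.\<close>

lemma eisenstein_factor_degree:
  fixes A B :: "'a :: idom poly" and p :: 'a
  assumes p: "prime_elem p"
    and lead: "\<not> p dvd lead_coeff (A * B)"
    and low: "\<And>i. i < degree (A * B) \<Longrightarrow> p dvd coeff (A * B) i"
    and const: "\<not> p\<^sup>2 dvd coeff (A * B) 0"
  shows "degree A = 0 \<or> degree B = 0"
proof (cases "degree (A * B) = 0")
  case True
  have "A * B \<noteq> 0" using lead by auto
  thus ?thesis using True by (auto simp: degree_mult_eq)
next
  case False
  have nz: "A * B \<noteq> 0" using lead by auto
  have deg: "degree (A * B) = degree A + degree B"
    using nz by (auto simp: degree_mult_eq)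
  have main: "degree D = 0"
    if eq: "C * D = A * B" and C0: "p dvd coeff C 0" and D0: "\<not> p dvd coeff D 0" for C D
  proof -
    have degCD: "degree (A * B) = degree C + degree D"
      using nz eq by (metis degree_mult_eq mult_eq_0_iff)
    have "\<not> p dvd lead_coeff C"
      using lead by (metis dvd_mult2 eq lead_coeff_mult)
    define k where "k = (LEAST i. \<not> p dvd coeff C i)"
    have k: "\<not> p dvd coeff C k"
      unfolding k_def using \<open>\<not> p dvd lead_coeff C\<close> by (rule LeastI)
    have k_le: "k \<le> degree C"
      unfolding k_def using \<open>\<not> p dvd lead_coeff C\<close> by (rule Least_le)
    have k_min: "p dvd coeff C i" if "i < k" for i
      using that not_less_Least unfolding k_def by blast
    have "coeff (A * B) k = (\<Sum>i\<le>k. coeff C i * coeff D (k - i))"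
      by (simp add: eq[symmetric] coeff_mult)
    also have "\<dots> = (\<Sum>i<k. coeff C i * coeff D (k - i)) + coeff C k * coeff D 0"
      by (simp add: lessThan_Suc_atMost[symmetric])
    finally have split: "coeff (A * B) k =
      (\<Sum>i<k. coeff C i * coeff D (k - i)) + coeff C k * coeff D 0" .
    have "p dvd (\<Sum>i<k. coeff C i * coeff D (k - i))"
      by (intro dvd_sum) (auto intro: dvd_mult2 k_min)
    moreover have "\<not> p dvd coeff C k * coeff D 0"
      using p k D0 by (simp add: prime_elem_dvd_mult_iff)
    ultimately have "\<not> p dvd coeff (A * B) k"
      unfolding split by (simp add: dvd_add_right_iff)
    with low have "degree (A * B) \<le> k" by (meson not_le)
    with k_le degCD show ?thesis by simp
  qed
  have "p dvd coeff A 0 * coeff B 0"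
    using low[of 0] False by (simp add: coeff_mult_0)
  moreover have "\<not> (p dvd coeff A 0 \<and> p dvd coeff B 0)"
    using const by (auto simp: coeff_mult_0 power2_eq_square intro: mult_dvd_mono)
  ultimately consider "p dvd coeff A 0" "\<not> p dvd coeff B 0" | "p dvd coeff B 0" "\<not> p dvd coeff A 0"
    using p by (auto simp: prime_elem_dvd_mult_iff)
  thus ?thesis using main[of A B] main[of B A] by cases (auto simp: mult.commute)
qed

section \<open>Minimal polynomials of points\<close>

lemma vanishes_at_imp_degree_pos:
  assumes "P \<noteq> 0" "vanishes_at P \<alpha>"
  shows "degree P > 0"
proof (rule ccontr)
  assume "\<not> degree P > 0"
  then obtain c where "P = [:c:]" by (meson degree_eq_zeroE not_gr_zero)
  thus False using assms by (auto simp: vanishes_at_def map_poly_pCons)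
qed

text \<open>Pseudo-division gives \<open>c * P = M * q + r\<close>, and \<open>r\<close> vanishes at
  the point, so it is 0 by minimality of the degree. As \<open>M\<close> has content 1, Gauss's
  lemma shows that \<open>c\<close> divides the content of \<open>q\<close> and can be cancelled, so
  the divisibility holds over the integers.\<close>

lemma is_minimal_poly_dvd:
  assumes M: "is_minimal_poly M \<alpha>" and P: "vanishes_at P \<alpha>"
  shows "M dvd P"
proof -
  have M0: "M \<noteq> 0" and Mc: "content M = 1" using M by (auto simp: is_minimal_poly_def)
  define r where "r = pseudo_mod P M"
  obtain c q where c: "c \<noteq> 0" "smult c P = M * q + r"
    using pseudo_mod(1)[OF M0] unfolding r_def by blast
  have r: "r = 0 \<or> degree r < degree M"
    using pseudo_mod(2)[OF M0] unfolding r_def by blast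
  have hom: "map_poly real_of_int (smult c P) = map_poly real_of_int M * map_poly real_of_int q + map_poly real_of_int r"
    unfolding c(2) by (rule poly_eqI) (simp add: coeff_map_poly coeff_mult)
  have "map_poly real_of_int (smult c P) = smult (of_int c) (map_poly of_int P)"
    by (rule poly_eqI) (simp add: coeff_map_poly)
  with hom have "vanishes_at r \<alpha>"
    using P M unfolding vanishes_at_def is_minimal_poly_def
    by (metis add_cancel_left_left mult_zero_left mult_zero_right poly_add poly_mult poly_smult)
  hence "r = 0" using r M unfolding is_minimal_poly_def by (meson not_le)
  hence eq: "smult c P = M * q" using c by simp
  hence "\<bar>c\<bar> * content P = content q"
    using Mc content_smult[of c P] by (simp add: content_mult)
  hence "c dvd content q" by (metis abs_dvd_iff dvd_triv_left)
  then obtain q' where "q = smult c q'"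
    by (metis const_poly_dvd_iff_dvd_content dvdE mult_pCons_left add_0_right pCons_0_0 mult_zero_left)
  hence "smult c P = smult c (M * q')" using eq by simp
  hence "P = M * q'" using c(1) by (metis smult_cancel)
  thus ?thesis by simp
qed

text \<open>The minimal polynomial divides \<open>P\<close> and is not constant, so Eisenstein's
  criterion makes the cofactor constant. Hence \<open>P\<close> has the least possible
  degree.\<close>

lemma is_minimal_poly_eisenstein:
  assumes p: "prime_elem (p :: int)"
    and lead: "\<not> p dvd lead_coeff P"
    and low: "\<And>i. i < degree P \<Longrightarrow> p dvd coeff P i"
    and const: "\<not> p\<^sup>2 dvd coeff P 0"
    and content: "content P = 1" and van: "vanishes_at P \<alpha>"
  shows "is_minimal_poly P \<alpha>"
proof -
  have P0: "P \<noteq> 0" using lead by auto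
  define M where "M = minimal_poly \<alpha>"
  have M: "is_minimal_poly M \<alpha>"
    unfolding M_def using P0 van by (intro minimal_poly_exists) (auto simp: algebraic_point_def)
  obtain S where S: "P = M * S" using is_minimal_poly_dvd[OF M van] by (auto elim: dvdE)
  have "degree M = 0 \<or> degree S = 0"
    using p lead low const unfolding S by (rule eisenstein_factor_degree)
  moreover have "degree M > 0"
    using M by (intro vanishes_at_imp_degree_pos[of M \<alpha>]) (auto simp: is_minimal_poly_def)
  ultimately have "degree P = degree M"
    using P0 unfolding S by (auto simp: degree_mult_eq)
  thus ?thesis using M P0 van content by (auto simp: is_minimal_poly_def)
qed

lemma minimal_poly_eqI:
  assumes "is_minimal_poly P \<alpha>"
  shows "minimal_poly \<alpha> = P \<or> minimal_poly \<alpha> = - P"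
proof -
  have "algebraic_point \<alpha>"
    using assms by (auto simp: algebraic_point_def is_minimal_poly_def)
  from minimal_poly_unique[OF minimal_poly_exists[OF this] assms] show ?thesis .
qed

lemma poly_height_minus: "poly_height (- P) = poly_height P"
  by (simp add: poly_height_def)

text \<open>Degree and height do not change with the sign, so they can be read off any minimal
  polynomial of the point.\<close>

lemma algebraic_pointsI:
  assumes "is_minimal_poly P \<alpha>" "degree P \<le> n" "\<And>i. i \<le> degree P \<Longrightarrow> of_int \<bar>coeff P i\<bar> \<le> Q"
  shows "\<alpha> \<in> algebraic_points n Q"
proof -
  have "poly_height P \<in> (\<lambda>j. \<bar>coeff P j\<bar>) ` {..degree P}"
    unfolding poly_height_def by (intro Max_in) auto
  hence "of_int (poly_height P) \<le> Q" using assms(3) by auto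
  thus ?thesis
    using assms(1,2) minimal_poly_eqI[OF assms(1)]
    by (auto simp: algebraic_points_def point_degree_def point_height_def poly_height_minus
        algebraic_point_def is_minimal_poly_def)
qed

lemma finite_int_polys_bounded:
  "finite {P :: int poly. degree P \<le> n \<and> (\<forall>i. \<bar>coeff P i\<bar> \<le> h)}"
proof (rule finite_subset)
  show "{P :: int poly. degree P \<le> n \<and> (\<forall>i. \<bar>coeff P i\<bar> \<le> h)}
    \<subseteq> Poly ` {xs. set xs \<subseteq> {-h..h} \<and> length xs = Suc n}"
  proof safe
    fix P :: "int poly" assume P: "degree P \<le> n" "\<forall>i. \<bar>coeff P i\<bar> \<le> h"
    have "P = Poly (map (coeff P) [0..<Suc n])"
      by (rule poly_eqI) (use P(1) in \<open>auto simp: nth_default_def coeff_eq_0 simp del: upt_Suc\<close>)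
    moreover have "set (map (coeff P) [0..<Suc n]) \<subseteq> {-h..h}"
    proof
      fix c assume "c \<in> set (map (coeff P) [0..<Suc n])"
      then obtain i where "c = coeff P i" by auto
      thus "c \<in> {-h..h}" using P(2)[rule_format, of i] by auto
    qed
    ultimately show "P \<in> Poly ` {xs. set xs \<subseteq> {-h..h} \<and> length xs = Suc n}"
      by (intro image_eqI[of _ _ "map (coeff P) [0..<Suc n]"]) auto
  qed
  show "finite (Poly ` {xs. set xs \<subseteq> {-h..h} \<and> length xs = Suc n})"
    by (intro finite_imageI finite_lists_length_eq) auto
qed

lemma abs_coeff_le_poly_height: "\<bar>coeff P i\<bar> \<le> poly_height P"
proof -
  have ge: "\<bar>coeff P j\<bar> \<le> poly_height P" if "j \<le> degree P" for j
    unfolding poly_height_def using that by (intro Max_ge) auto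
  show ?thesis
  proof (cases "i \<le> degree P")
    case False
    thus ?thesis using ge[of 0] by (simp add: coeff_eq_0)
  qed (rule ge)
qed

text \<open>Finitely many polynomials are eligible, each with finitely many pairs of roots.
  Finiteness matters because \<open>card\<close> is 0 on infinite sets and lower bounds are passed
  on along inclusions.\<close>

lemma finite_algebraic_points: "finite (algebraic_points n Q)"
proof (rule finite_subset)
  let ?Ps = "{P :: int poly. degree P \<le> n \<and> (\<forall>i. \<bar>coeff P i\<bar> \<le> \<lfloor>Q\<rfloor>)} - {0}"
  let ?roots = "\<lambda>P :: int poly. {x :: real. poly (map_poly of_int P) x = 0}"
  show "algebraic_points n Q \<subseteq> (\<Union>P\<in>?Ps. ?roots P \<times> ?roots P)"
  proof
    fix \<alpha> assume \<alpha>: "\<alpha> \<in> algebraic_points n Q"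
    hence M: "is_minimal_poly (minimal_poly \<alpha>) \<alpha>"
      by (intro minimal_poly_exists) (simp add: algebraic_points_def)
    have "poly_height (minimal_poly \<alpha>) \<le> \<lfloor>Q\<rfloor>"
      using \<alpha> by (simp add: algebraic_points_def point_height_def le_floor_iff)
    hence "\<bar>coeff (minimal_poly \<alpha>) i\<bar> \<le> \<lfloor>Q\<rfloor>" for i
      using abs_coeff_le_poly_height order_trans by blast
    hence "minimal_poly \<alpha> \<in> ?Ps"
      using \<alpha> M by (auto simp: algebraic_points_def point_degree_def is_minimal_poly_def)
    thus "\<alpha> \<in> (\<Union>P\<in>?Ps. ?roots P \<times> ?roots P)"
      using M by (intro UN_I[of "minimal_poly \<alpha>"])
        (auto simp: is_minimal_poly_def vanishes_at_def mem_Times_iff)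
  qed
  have "finite (?roots P)" if "P \<noteq> 0" for P
    using that by (intro poly_roots_finite) (simp add: map_poly_eq_0_iff)
  thus "finite (\<Union>P\<in>?Ps. ?roots P \<times> ?roots P)"
    by (intro finite_UN_I finite_Diff finite_int_polys_bounded finite_cartesian_product) auto
qed

section \<open>Sieving out common prime factors\<close>

text \<open>Congruent elements are told apart by the quotient of \<open>v - v0\<close> by
  \<open>p\<close>, which takes at most \<open>m div p + 1\<close> values.\<close>

lemma card_residue_class_le:
  fixes p :: int
  assumes p: "p > 0" and S: "S \<subseteq> {v0..<v0 + int m}"
    and cong: "\<And>v w. v \<in> S \<Longrightarrow> w \<in> S \<Longrightarrow> p dvd v - w"
  shows "real (card S) \<le> real m / of_int p + 1"
proof (cases "m = 0")
  case True
  thus ?thesis using S by auto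
next
  case False
  let ?g = "\<lambda>v. (v - v0) div p"
  have "inj_on ?g S"
  proof (rule inj_onI)
    fix v w assume *: "v \<in> S" "w \<in> S" "?g v = ?g w"
    have "p dvd (v - v0) - (w - v0)" using cong[OF *(1,2)] by simp
    hence "(v - v0) mod p = (w - v0) mod p" by (simp add: mod_eq_dvd_iff)
    with *(3) show "v = w" by (metis diff_add_cancel mult_div_mod_eq)
  qed
  moreover have "?g ` S \<subseteq> {0..int m div p}"
    using S p by (force intro!: zdiv_mono1 simp: pos_imp_zdiv_nonneg_iff)
  ultimately have "card S \<le> card {0..int m div p}"
    by (metis card_image card_mono finite_atLeastAtMost_int)
  moreover have "0 \<le> int m div p" using p by (simp add: pos_imp_zdiv_nonneg_iff)
  ultimately have "int (card S) \<le> int m div p + 1" by simp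
  hence "real (card S) \<le> of_int (int m div p + 1)" by linarith
  also have "\<dots> \<le> real m / of_int p + 1"
    using real_of_int_div4[of "int m" p] by simp
  finally show ?thesis .
qed

text \<open>Telescoping with \<open>1 / k^2 <= 1 / (k - 1) - 1 / k\<close> from \<open>k = 3\<close>
  on.\<close>

lemma sum_inverse_squares_le:
  assumes "finite F" "F \<subseteq> {3::int..}"
  shows "(\<Sum>k\<in>F. 1 / (of_int k)\<^sup>2) \<le> (1 / 2 :: real)"
proof -
  have partial: "(\<Sum>k=3..<3+N. 1 / (real k)\<^sup>2) \<le> 1 / 2 - 1 / (real N + 2)" for N
  proof (induction N)
    case (Suc N)
    have step: "1 / (real N + 3)\<^sup>2 \<le> 1 / (real N + 2) - 1 / (real N + 3)"
      by (simp add: divide_simps power2_eq_square)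
    have "(\<Sum>k=3..<3+Suc N. 1 / (real k)\<^sup>2) = (\<Sum>k=3..<3+N. 1 / (real k)\<^sup>2) + 1 / (real N + 3)\<^sup>2"
      by (subst add_Suc_right, subst sum.atLeastLessThan_Suc) (simp_all add: add.commute)
    also have "\<dots> \<le> 1 / 2 - 1 / (real N + 3)" using Suc.IH step by linarith
    finally show ?case by (simp add: add.commute)
  qed simp
  define N where "N = nat (Max F) + 1"
  have N: "F \<subseteq> {..<int N}"
  proof
    fix k assume "k \<in> F"
    hence "k \<le> Max F" using assms(1) by simp
    thus "k \<in> {..<int N}" by (simp add: N_def)
  qed
  have "(\<Sum>k\<in>F. 1 / (of_int k)\<^sup>2) = (\<Sum>k\<in>nat ` F. 1 / (real k)\<^sup>2)"
    using assms by (subst sum.reindex) (auto intro!: sum.cong simp: inj_on_def)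
  also have "\<dots> \<le> (\<Sum>k=3..<3+N. 1 / (real k)\<^sup>2)"
    using N assms(2) by (intro sum_mono2) (auto simp: subset_iff)
  also have "\<dots> \<le> 1 / 2" using partial[of N] by (smt (verit) divide_nonneg_nonneg of_nat_0_le_iff)
  finally show ?thesis .
qed

text \<open>Used to bound the number of primes in the sieve by a logarithm.\<close>

lemma two_power_card_prime_factors_le:
  fixes q :: int
  assumes "q > 0"
  shows "2 ^ card (prime_factors q) \<le> q"
proof -
  have "(2::int) ^ card (prime_factors q) = (\<Prod>p\<in>prime_factors q. 2)" by simp
  also have "\<dots> \<le> (\<Prod>p\<in>prime_factors q. p ^ multiplicity p q)"
  proof (rule prod_mono)
    fix p assume p: "p \<in> prime_factors q"
    have "2 \<le> p" using p by (auto simp: in_prime_factors_iff prime_ge_2_int)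
    also have "p ^ 1 \<le> p ^ multiplicity p q"
      using p \<open>2 \<le> p\<close> by (intro power_increasing) (auto simp: prime_factors_multiplicity)
    finally show "0 \<le> (2::int) \<and> 2 \<le> p ^ multiplicity p q" by simp
  qed
  also have "\<dots> = q" using assms prod_prime_factors[of q] by simp
  finally show ?thesis .
qed

text \<open>A union bound: each prime \<open>p\<close> dividing \<open>q\<close> is at least 3 and
  spoils at most \<open>(m / p + 1)^2 <= m^2 / p^2 + 3 * m\<close> pairs. The main terms add up to
  at most \<open>m^2 / 2\<close>. There are at most \<open>m / 12\<close> primes, so the error terms
  add up to at most \<open>m^2 / 4\<close>, which leaves a quarter of all pairs.\<close>

lemma card_primitive_pairs_ge:
  fixes q u0 v0 :: int and m :: nat
  assumes q: "q > 0" and odd: "odd q" and small: "12 * log 2 (of_int q) \<le> real m"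
  shows "real m ^ 2 / 4 \<le> real (card {(u, v) \<in> {u0..<u0 + int m} \<times> {v0..<v0 + int m}.
           \<forall>p. prime p \<longrightarrow> p dvd q \<longrightarrow> p dvd u \<longrightarrow> \<not> p dvd 2 * v + 1})"
    (is "_ \<le> real (card ?G)")
proof (cases "m = 0")
  case False
  let ?U = "{u0..<u0 + int m}" and ?V = "{v0..<v0 + int m}"
  let ?Up = "\<lambda>p. {u \<in> ?U. p dvd u}" and ?Vp = "\<lambda>p. {v \<in> ?V. p dvd 2 * v + 1}"
  define F where "F = prime_factors q"
  have finF: "finite F" by (simp add: F_def)
  have F: "prime p" "p dvd q" "p \<ge> 3" if "p \<in> F" for p
  proof -
    show "prime p" "p dvd q" using that by (auto simp: F_def in_prime_factors_iff)
    moreover from this have "p \<noteq> 2" using odd by auto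
    ultimately show "p \<ge> 3" using prime_ge_2_int[of p] by linarith
  qed
  have omega: "12 * real (card F) \<le> real m"
  proof -
    have "real (card F) = log 2 (2 ^ card F)" by simp
    also have "\<dots> \<le> log 2 (of_int q)"
    proof (subst log_le_cancel_iff)
      have "real_of_int (2 ^ card F) \<le> of_int q"
        using two_power_card_prime_factors_le[OF q] unfolding F_def of_int_le_iff .
      thus "2 ^ card F \<le> real_of_int q" by simp
    qed (use q in auto)
    finally show ?thesis using small by linarith
  qed
  have "?U \<times> ?V \<subseteq> ?G \<union> (\<Union>p\<in>F. ?Up p \<times> ?Vp p)"
    using q by (auto simp: F_def in_prime_factors_iff)
  hence "card (?U \<times> ?V) \<le> card (?G \<union> (\<Union>p\<in>F. ?Up p \<times> ?Vp p))"
    by (rule card_mono[rotated])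
      (intro finite_UnI finite_UN_I finF finite_cartesian_product finite_subset[of ?G "?U \<times> ?V"]
        finite_subset[of "?Up _" ?U] finite_subset[of "?Vp _" ?V]; auto)
  also have "\<dots> \<le> card ?G + card (\<Union>p\<in>F. ?Up p \<times> ?Vp p)" by (rule card_Un_le)
  also have "card (\<Union>p\<in>F. ?Up p \<times> ?Vp p) \<le> (\<Sum>p\<in>F. card (?Up p \<times> ?Vp p))"
    by (rule card_UN_le[OF finF])
  finally have "real (m * m) \<le> real (card ?G + (\<Sum>p\<in>F. card (?Up p \<times> ?Vp p)))"
    by (simp add: card_cartesian_product of_nat_le_iff[symmetric, where 'a = real] del: of_nat_le_iff)
  hence total: "real m ^ 2 \<le> real (card ?G) + (\<Sum>p\<in>F. real (card (?Up p)) * real (card (?Vp p)))"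
    by (simp add: power2_eq_square card_cartesian_product)
  have "(\<Sum>p\<in>F. real (card (?Up p)) * real (card (?Vp p)))
      \<le> (\<Sum>p\<in>F. real m ^ 2 * (1 / (of_int p)\<^sup>2) + 3 * real m)"
  proof (rule sum_mono)
    fix p assume p: "p \<in> F"
    let ?t = "real m / of_int p"
    have "real (card (?Up p)) \<le> ?t + 1"
      using F[OF p] by (intro card_residue_class_le) (auto intro: dvd_diff)
    moreover have "real (card (?Vp p)) \<le> ?t + 1"
    proof (intro card_residue_class_le)
      fix v w assume "v \<in> ?Vp p" "w \<in> ?Vp p"
      hence "p dvd (2 * v + 1) - (2 * w + 1)" by (intro dvd_diff) auto
      hence "p dvd 2 * (v - w)" by (simp add: algebra_simps)
      moreover have "\<not> p dvd 2" using F[OF p] zdvd_imp_le[of p 2] by auto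
      ultimately show "p dvd v - w" using F[OF p] prime_dvd_mult_iff by blast
    qed (use F[OF p] in auto)
    ultimately have "real (card (?Up p)) * real (card (?Vp p)) \<le> (?t + 1) * (?t + 1)"
      by (intro mult_mono) auto
    also have "\<dots> = real m ^ 2 * (1 / (of_int p)\<^sup>2) + (2 * ?t + 1)"
      by (simp add: power2_eq_square algebra_simps)
    also have "2 * ?t + 1 \<le> 3 * real m"
    proof -
      have "?t \<le> real m / 1" using F[OF p] by (intro divide_left_mono) auto
      moreover have "1 \<le> real m" using False by simp
      ultimately show ?thesis by simp
    qed
    finally show "real (card (?Up p)) * real (card (?Vp p)) \<le>
        real m ^ 2 * (1 / (of_int p)\<^sup>2) + 3 * real m" by simp
  qed
  also have "\<dots> = real m ^ 2 * (\<Sum>p\<in>F. 1 / (of_int p)\<^sup>2) + 3 * real (card F) * real m"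
    by (simp add: sum.distrib sum_distrib_left)
  also have "\<dots> \<le> real m ^ 2 * (1 / 2) + (real m / 4) * real m"
    using F finF omega by (intro add_mono mult_left_mono mult_right_mono sum_inverse_squares_le) auto
  finally show ?thesis using total by (simp add: power2_eq_square)
qed simp

section \<open>Zeros near approximate zeros\<close>

text \<open>On each side of \<open>x\<close> the function changes by at least \<open>D * r\<close>,
  which exceeds its size at \<open>x\<close>. So it has opposite signs at the two ends of the
  interval.\<close>

lemma zero_near_of_large_derivative:
  fixes g g' :: "real \<Rightarrow> real"
  assumes r: "r > 0"
    and deriv: "\<And>t. t \<in> {x - r..x + r} \<Longrightarrow> (g has_real_derivative g' t) (at t)"
    and large: "\<And>t. t \<in> {x - r..x + r} \<Longrightarrow> D \<le> g' t"
    and small: "\<bar>g x\<bar> < D * r"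
  shows "\<exists>z. \<bar>z - x\<bar> < r \<and> g z = 0"
proof -
  have "\<exists>\<xi>>x. \<xi> < x + r \<and> g (x + r) - g x = (x + r - x) * g' \<xi>"
    using r deriv by (intro MVT2) auto
  then obtain \<xi> where "\<xi> > x" "\<xi> < x + r" "g (x + r) - g x = r * g' \<xi>" by auto
  moreover from this have "r * D \<le> r * g' \<xi>" using large[of \<xi>] r by simp
  ultimately have pos: "g (x + r) > 0" using small mult.commute[of D r] by linarith
  have "\<exists>\<xi>>x - r. \<xi> < x \<and> g x - g (x - r) = (x - (x - r)) * g' \<xi>"
    using r deriv by (intro MVT2) auto
  then obtain \<xi> where "\<xi> > x - r" "\<xi> < x" "g x - g (x - r) = r * g' \<xi>" by auto
  moreover from this have "r * D \<le> r * g' \<xi>" using large[of \<xi>] r by simp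
  ultimately have neg: "g (x - r) < 0" using small mult.commute[of D r] by linarith
  have "\<exists>z\<ge>x - r. z \<le> x + r \<and> g z = 0"
    using r pos neg deriv[THEN DERIV_isCont]
    by (intro IVT') (auto intro!: continuous_at_imp_continuous_on)
  then obtain z where "z \<ge> x - r" "z \<le> x + r" "g z = 0" by auto
  moreover from this have "z \<noteq> x - r" "z \<noteq> x + r" using pos neg by auto
  ultimately show ?thesis by (intro exI[of _ z]) auto
qed

lemma MVT_slope:
  fixes T T' :: "real \<Rightarrow> real"
  assumes "\<And>t. t \<in> {l..h} \<Longrightarrow> (T has_real_derivative T' t) (at t)"
    and "x \<in> {l..h}" "y \<in> {l..h}" "x \<noteq> y"
  shows "\<exists>\<xi>\<in>{l..h}. (T y - T x) / (y - x) = T' \<xi>"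
proof -
  have *: "\<exists>\<xi>\<in>{l..h}. (T v - T u) / (v - u) = T' \<xi>" if "u \<in> {l..h}" "v \<in> {l..h}" "u < v" for u v
  proof -
    have "\<exists>\<xi>>u. \<xi> < v \<and> T v - T u = (v - u) * T' \<xi>"
      using that assms(1) by (intro MVT2) auto
    then obtain \<xi> where "u < \<xi>" "\<xi> < v" "T v - T u = (v - u) * T' \<xi>" by blast
    thus ?thesis using that by (intro bexI[of _ \<xi>]) auto
  qed
  have "(T y - T x) / (y - x) = (T x - T y) / (x - y)"
    using minus_divide_divide[of "T y - T x" "y - x"] by simp
  thus ?thesis using *[of x y] *[of y x] assms by (cases x y rule: linorder_cases) auto
qed

text \<open>By \<open>slope\<close>, \<open>a1\<close> nearly cancels the slope of the secant of
  \<open>c2 * t^2 + T t\<close> through \<open>x\<close> and \<open>y\<close>. The derivative near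
  \<open>x\<close> is therefore \<open>c2 * (x - y)\<close> up to three errors:
  \<open>2 * \<bar>c2\<bar> * r\<close> from moving away from \<open>x\<close>,
  \<open>2 * \<tau>\<close> from two values of \<open>T'\<close>, and \<open>E\<close>. The
  hypothesis \<open>gap\<close> leaves at least \<open>D\<close> in absolute value.\<close>

lemma zero_near_perturbed_quadratic:
  fixes T T' :: "real \<Rightarrow> real"
  assumes r: "r > 0" and x: "{x - r..x + r} \<subseteq> {-X..X}" and y: "y \<in> {-X..X}" and ne: "x \<noteq> y"
    and deriv: "\<And>t. (T has_real_derivative T' t) (at t)"
    and bound: "\<And>t. t \<in> {-X..X} \<Longrightarrow> \<bar>T' t\<bar> \<le> \<tau>"
    and slope: "\<bar>a1 + c2 * (x + y) + (T y - T x) / (y - x)\<bar> \<le> E"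
    and gap: "D + 2 * \<bar>c2\<bar> * r + 2 * \<tau> + E \<le> \<bar>c2\<bar> * \<bar>x - y\<bar>" and c2: "c2 \<noteq> 0"
    and small: "\<bar>c2 * x\<^sup>2 + T x + a1 * x + a0\<bar> < D * r"
  shows "\<exists>z. \<bar>z - x\<bar> < r \<and> c2 * z\<^sup>2 + T z + a1 * z + a0 = 0"
proof -
  have xX: "x \<in> {-X..X}" using r x by force
  obtain \<xi> where \<xi>: "\<xi> \<in> {-X..X}" "(T y - T x) / (y - x) = T' \<xi>"
    using MVT_slope[of "-X" X T T' x y] deriv xX y ne by blast
  define e where "e = a1 + c2 * (x + y) + T' \<xi>"
  have e: "\<bar>e\<bar> \<le> E" using slope \<xi> by (simp add: e_def)
  \<comment> \<open>Multiplying by this sign makes the derivative positive, so that a lower bound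
    for it suffices.\<close>
  define s where "s = sgn (c2 * (x - y))"
  have s: "\<bar>s\<bar> = 1" "s * (c2 * (x - y)) = \<bar>c2\<bar> * \<bar>x - y\<bar>"
    using c2 ne by (auto simp: s_def abs_mult sgn_mult abs_sgn mult_ac)
  have "\<exists>z. \<bar>z - x\<bar> < r \<and> s * (c2 * z\<^sup>2 + T z + a1 * z + a0) = 0"
  proof (rule zero_near_of_large_derivative[where D = D])
    show "((\<lambda>z. s * (c2 * z\<^sup>2 + T z + a1 * z + a0)) has_real_derivative
        s * (2 * c2 * t + T' t + a1)) (at t)" for t
      by (auto intro!: derivative_eq_intros deriv)
    fix t assume t: "t \<in> {x - r..x + r}"
    let ?w = "2 * c2 * (t - x) + T' t - T' \<xi> + e"
    have "\<bar>2 * c2 * (t - x)\<bar> \<le> 2 * \<bar>c2\<bar> * r"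
      using t unfolding abs_mult by (intro mult_mono) auto
    moreover have "\<bar>T' t\<bar> \<le> \<tau>" "\<bar>T' \<xi>\<bar> \<le> \<tau>" using bound t x \<xi> by auto
    ultimately have "\<bar>?w\<bar> \<le> 2 * \<bar>c2\<bar> * r + 2 * \<tau> + E" using e by linarith
    hence "\<bar>s * ?w\<bar> \<le> 2 * \<bar>c2\<bar> * r + 2 * \<tau> + E" using s by (simp add: abs_mult)
    moreover have "s * (2 * c2 * t + T' t + a1) = s * (c2 * (x - y)) + s * ?w"
      by (simp add: e_def algebra_simps)
    ultimately show "D \<le> s * (2 * c2 * t + T' t + a1)" using gap s(2) by linarith
  qed (use r small s in \<open>auto simp: abs_mult\<close>)
  thus ?thesis using s by auto
qed

section \<open>A family of Eisenstein polynomials\<close>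

text \<open>The parities make every member Eisenstein at 2, in a set of coefficient vectors of positive
  density.\<close>
definition upper_coeff :: "nat \<Rightarrow> (nat \<Rightarrow> int) \<Rightarrow> nat \<Rightarrow> int" where
  "upper_coeff n w i = 2 * w i + (if i = n then 1 else 0)"

definition family_coeff :: "nat \<Rightarrow> (nat \<Rightarrow> int) \<Rightarrow> int \<Rightarrow> int \<Rightarrow> nat \<Rightarrow> int" where
  "family_coeff n w u v i =
     (if i = 0 then 4 * v + 2 else if i = 1 then 2 * u else upper_coeff n w i)"

definition family_poly :: "nat \<Rightarrow> (nat \<Rightarrow> int) \<Rightarrow> int \<Rightarrow> int \<Rightarrow> int poly" where
  "family_poly n w u v = (\<Sum>i\<le>n. monom (family_coeff n w u v i) i)"

lemma coeff_family_poly: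
  "coeff (family_poly n w u v) i = (if i \<le> n then family_coeff n w u v i else 0)"
  by (simp add: family_poly_def coeff_sum)

lemma degree_family_poly:
  assumes "n \<ge> 2"
  shows "degree (family_poly n w u v) = n"
proof (rule antisym)
  show "degree (family_poly n w u v) \<le> n"
    by (rule degree_le) (simp add: coeff_family_poly)
  have "2 * w n + 1 \<noteq> 0" by presburger
  thus "n \<le> degree (family_poly n w u v)"
    using assms by (intro le_degree) (simp add: coeff_family_poly family_coeff_def upper_coeff_def)
qed

text \<open>The splitting into quadratic term, tail, linear and constant term matches
  \<open>zero_near_perturbed_quadratic\<close>.\<close>

lemma poly_family_poly:
  assumes "n \<ge> 2"
  shows "poly (map_poly of_int (family_poly n w u v)) (t :: real) =
    of_int (upper_coeff n w 2) * t\<^sup>2 + (\<Sum>i=3..n. of_int (upper_coeff n w i) * t ^ i)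
      + of_int (2 * u) * t + of_int (4 * v + 2)"
proof -
  let ?c = "\<lambda>i. of_int (family_coeff n w u v i) * t ^ i"
  have "map_poly real_of_int (family_poly n w u v) =
      (\<Sum>i\<le>n. monom (of_int (family_coeff n w u v i)) i)"
    by (rule poly_eqI) (simp add: coeff_map_poly coeff_family_poly coeff_sum)
  hence "poly (map_poly of_int (family_poly n w u v)) t = (\<Sum>i\<le>n. ?c i)"
    by (simp add: poly_sum poly_monom)
  also have "{..n} = {0, 1, 2} \<union> {3..n}" using assms by auto
  also have "(\<Sum>i\<in>\<dots>. ?c i) = (\<Sum>i\<in>{0, 1, 2}. ?c i) + (\<Sum>i=3..n. ?c i)"
    by (intro sum.union_disjoint) auto
  finally show ?thesis by (simp add: family_coeff_def)
qed

text \<open>A prime dividing all coefficients divides the odd leading one, so it is odd and must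
  divide both \<open>u\<close> and \<open>2 * v + 1\<close>. This is what \<open>prim\<close>
  excludes.\<close>

lemma is_minimal_poly_family_poly:
  assumes n: "n \<ge> 2" and van: "vanishes_at (family_poly n w u v) \<alpha>"
    and prim: "\<And>p. prime p \<Longrightarrow> p dvd 2 * w n + 1 \<Longrightarrow> p dvd u \<Longrightarrow> \<not> p dvd 2 * v + 1"
  shows "is_minimal_poly (family_poly n w u v) \<alpha>"
proof (rule is_minimal_poly_eisenstein[of 2])
  let ?P = "family_poly n w u v"
  show "\<not> 2 dvd lead_coeff ?P"
    using n by (simp add: degree_family_poly coeff_family_poly family_coeff_def upper_coeff_def)
  show "2 dvd coeff ?P i" if "i < degree ?P" for i
    using that n by (simp add: degree_family_poly coeff_family_poly family_coeff_def upper_coeff_def)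
  have "\<not> 4 dvd 4 * v + 2" by presburger
  thus "\<not> 2\<^sup>2 dvd coeff ?P 0" by (simp add: coeff_family_poly family_coeff_def upper_coeff_def)
  show "content ?P = 1"
  proof (rule ccontr)
    assume "content ?P \<noteq> 1"
    hence "\<not> is_unit (content ?P)" using is_unit_content_iff by blast
    moreover have "?P \<noteq> 0" using degree_family_poly[OF n, of w u v] n by auto
    ultimately obtain p where p: "p dvd content ?P" "prime p"
      using prime_divisor_exists[of "content ?P"] by auto
    have dvd: "p dvd coeff ?P i" for i using p(1) content_dvd_coeff dvd_trans by blast
    have "p dvd 2 * w n + 1" "p dvd 2 * u" "p dvd 4 * v + 2"
      using dvd[of n] dvd[of 1] dvd[of 0] n by (auto simp: coeff_family_poly family_coeff_def upper_coeff_def)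
    moreover have "\<not> p dvd 2"
    proof
      assume "p dvd 2"
      hence "p dvd (2 * w n + 1) - 2 * w n"
        using \<open>p dvd 2 * w n + 1\<close> by (intro dvd_diff) auto
      hence "p dvd 1" by simp
      thus False using p(2) not_prime_unit by blast
    qed
    moreover have "4 * v + 2 = 2 * (2 * v + 1)" by simp
    ultimately show False using prim[of p] p(2) by (metis prime_dvd_mult_iff)
  qed
qed (use van in \<open>simp_all\<close>)

lemma family_poly_inject:
  assumes "n \<ge> 2" and "family_poly n w u v = family_poly n w' u' v'"
  shows "u = u'" "v = v'" "\<And>i. i \<in> {2..n} \<Longrightarrow> w i = w' i"
proof -
  have *: "family_coeff n w u v i = family_coeff n w' u' v' i" if "i \<le> n" for i
    using that arg_cong[OF assms(2), of "\<lambda>P. coeff P i"] by (simp add: coeff_family_poly)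
  show "u = u'" "v = v'" using *[of 1] *[of 0] assms(1) by (auto simp: family_coeff_def upper_coeff_def)
  show "w i = w' i" if "i \<in> {2..n}" for i
    using that *[of i] by (auto simp: family_coeff_def upper_coeff_def split: if_splits)
qed

text \<open>The exponents \<open>k i\<close> are left open so that the bound serves both the tail
  and its derivative.\<close>

lemma abs_sum_monomials_le:
  fixes c :: "nat \<Rightarrow> real"
  assumes "\<And>i. i \<in> {3..n} \<Longrightarrow> \<bar>c i\<bar> \<le> h" "\<bar>t\<bar> \<le> X" "X \<ge> 1" "h \<ge> 0"
    "\<And>i. i \<in> {3..n} \<Longrightarrow> k i \<le> n"
  shows "\<bar>\<Sum>i=3..n. c i * t ^ k i\<bar> \<le> real n * (h * X ^ n)"
proof -
  have "\<bar>\<Sum>i=3..n. c i * t ^ k i\<bar> \<le> (\<Sum>i=3..n. h * X ^ n)"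
  proof (rule order_trans[OF sum_abs], rule sum_mono)
    fix i assume i: "i \<in> {3..n}"
    have "\<bar>t\<bar> ^ k i \<le> X ^ k i" using assms by (intro power_mono) auto
    also have "\<dots> \<le> X ^ n" using assms i by (intro power_increasing) auto
    finally show "\<bar>c i * t ^ k i\<bar> \<le> h * X ^ n"
      unfolding abs_mult power_abs using assms i by (intro mult_mono) auto
  qed
  also have "\<dots> = real (card {3..n}) * (h * X ^ n)" by simp
  also have "\<dots> \<le> real n * (h * X ^ n)"
    using assms by (intro mult_right_mono) auto
  finally show ?thesis .
qed

section \<open>Counting points near the graph\<close>

text \<open>The polynomial with the given upper coefficients that vanishes at both \<open>x\<close> and \<open>y\<close> has
  linear coefficient \<open>- secant_slope n w x y\<close> and constant coefficient
  \<open>- secant_const n w x y\<close>.\<close>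
definition secant_slope :: "nat \<Rightarrow> (nat \<Rightarrow> int) \<Rightarrow> real \<Rightarrow> real \<Rightarrow> real" where
  "secant_slope n w x y = (let T = (\<lambda>t. \<Sum>i=3..n. of_int (upper_coeff n w i) * t ^ i)
     in of_int (upper_coeff n w 2) * (x + y) + (T y - T x) / (y - x))"

definition secant_const :: "nat \<Rightarrow> (nat \<Rightarrow> int) \<Rightarrow> real \<Rightarrow> real \<Rightarrow> real" where
  "secant_const n w x y = of_int (upper_coeff n w 2) * x\<^sup>2
     + (\<Sum>i=3..n. of_int (upper_coeff n w i) * x ^ i) - secant_slope n w x y * x"

lemma secant_slope_commute: "secant_slope n w x y = secant_slope n w y x"
proof -
  have "(S - R) / (y - x) = (R - S) / (x - y)" for R S :: real
    using minus_divide_divide[of "S - R" "y - x"] by simp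
  thus ?thesis by (simp add: secant_slope_def Let_def add.commute)
qed

text \<open>Slope and constant describe the line through the points above \<open>x\<close> and
  \<open>y\<close> on the graph of the part of degree at least 2, and this line is symmetric in
  \<open>x\<close> and \<open>y\<close>. The same pair of low coefficients thus serves both
  zeros.\<close>

lemma secant_const_commute:
  assumes "x \<noteq> y"
  shows "secant_const n w x y = secant_const n w y x"
proof -
  define T where "T = (\<lambda>t. \<Sum>i=3..n. of_int (upper_coeff n w i) * t ^ i :: real)"
  define c where "c = real_of_int (upper_coeff n w 2)"
  have "(y - x) * secant_slope n w x y = c * (y\<^sup>2 - x\<^sup>2) + (T y - T x)"
    using assms unfolding secant_slope_def Let_def T_def[symmetric] c_def[symmetric]
    by (simp add: distrib_left power2_eq_square) (simp add: algebra_simps)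
  hence "c * x\<^sup>2 + T x - secant_slope n w x y * x = c * y\<^sup>2 + T y - secant_slope n w x y * y"
    by (simp add: algebra_simps)
  thus ?thesis
    unfolding secant_const_def T_def c_def by (simp add: secant_slope_commute[of n w y x])
qed

text \<open>The coefficient of \<open>t\<^sup>2\<close>, of size \<open>B\<close>, dominates the higher ones, of size \<open>N\<close>: this keeps
  the derivative at both prescribed zeros at distance \<open>d\<close> of size \<open>B * d\<close>, whatever the signs of
  the zeros are.\<close>
locale box_family =
  fixes n B N :: nat and X d r :: real
  assumes n: "n \<ge> 2" and X: "X \<ge> 1" and d: "0 < d" "d \<le> 1" and r: "0 < r" "r \<le> d / 8"
    and B: "B \<ge> 1" and N: "16 * (real n)\<^sup>2 * X ^ n * real N \<le> real B * d"
begin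

text \<open>How far the two lowest coefficients may be from those of the polynomial that vanishes at
  the centre of the box without the zeros leaving the box of radius \<open>r\<close>.\<close>
definition tol :: real where "tol = real B * d * r / (8 * (1 + X))"

lemma tol_pos: "tol > 0" and tol_X: "tol * (1 + X) = real B * d * r / 8"
  and tol_le: "tol \<le> real B * d / 16"
proof -
  show "tol > 0" using B d r X by (simp add: tol_def)
  show *: "tol * (1 + X) = real B * d * r / 8" using X by (simp add: tol_def divide_simps)
  have "tol * 2 \<le> tol * (1 + X)" using X \<open>tol > 0\<close> by (intro mult_left_mono) auto
  also have "\<dots> \<le> real B * d * 1 / 8"
    unfolding * using r d B by (intro divide_right_mono mult_left_mono) auto
  finally show "tol \<le> real B * d / 16" by simp
qed

text \<open>The ranges are nonnegative so that leading coefficients are positive and no two members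
  of the family differ by a sign.\<close>

definition weights :: "(nat \<Rightarrow> int) set" where
  "weights = (\<Pi>\<^sub>E i\<in>{2..n}. if i = 2 then {int B..<2 * int B} else {0..<int N})"

lemma card_weights: "card weights = B * N ^ (n - 2)"
proof -
  have "card weights = (\<Prod>i\<in>{2..n}. card (if i = 2 then {int B..<2 * int B} else {0..<int N}))"
    unfolding weights_def by (rule card_PiE) simp
  also have "{2..n} = insert 2 {3..n}" using n by auto
  also have "(\<Prod>i\<in>\<dots>. card (if i = 2 then {int B..<2 * int B} else {0..<int N})) = B * (\<Prod>i\<in>{3..n}. N)"
    by (subst prod.insert) (auto intro!: prod.cong)
  also have "\<dots> = B * N ^ (n - 2)" by (simp add: eval_nat_numeral Suc_diff_Suc)
  finally show ?thesis .
qed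

lemma finite_weights: "finite weights"
  unfolding weights_def by (rule finite_PiE) auto

lemma upper_coeff_2: "w \<in> weights \<Longrightarrow> 2 * int B \<le> upper_coeff n w 2 \<and> upper_coeff n w 2 \<le> 4 * int B"
  using n by (auto simp: weights_def upper_coeff_def PiE_iff dest!: bspec[of _ _ 2])

lemma upper_coeff_ge_3: "w \<in> weights \<Longrightarrow> i \<in> {3..n} \<Longrightarrow> 0 \<le> upper_coeff n w i \<and> upper_coeff n w i \<le> 2 * int N"
  by (auto simp: weights_def upper_coeff_def PiE_iff dest!: bspec[of _ _ i])

text \<open>Applied with \<open>k = 1\<close> to the tail and with \<open>k = n\<close> to its
  derivative, whose coefficients gain a factor of at most \<open>n\<close>.\<close>

lemma N_bound:
  assumes "k \<le> n"
  shows "real n * (real k * (2 * real N) * X ^ n) \<le> real B * d / 8"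
proof -
  have "real n * (real k * (2 * real N) * X ^ n) \<le> real n * (real n * (2 * real N) * X ^ n)"
    using assms X by (intro mult_left_mono mult_right_mono) auto
  also have "\<dots> = 16 * (real n)\<^sup>2 * X ^ n * real N / 8" by (simp add: power2_eq_square)
  finally show ?thesis using N by linarith
qed

lemma two_N_le: "2 * real N \<le> real B * d / 8"
proof -
  have "1 * 1 \<le> real n * X ^ n" using n X by (intro mult_mono) (auto simp: one_le_power)
  hence "2 * real N * 1 \<le> (2 * real N) * (real n * (real 1 * X ^ n))"
    by (intro mult_left_mono) auto
  also have "\<dots> \<le> real B * d / 8" using N_bound[of 1] n by (simp add: mult_ac)
  finally show ?thesis by simp
qed

lemma N_le_B: "2 * N \<le> B"
proof -
  have "real B * d / 8 \<le> real B * 1 / 1" using d B by (intro frac_le mult_left_mono) auto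
  thus ?thesis using two_N_le by linarith
qed

context
  fixes w :: "nat \<Rightarrow> int" and x y :: real
  assumes w: "w \<in> weights" and x: "\<bar>x\<bar> + 1 \<le> X" and y: "\<bar>y\<bar> + 1 \<le> X" and xy: "d \<le> \<bar>x - y\<bar>"
begin

lemma tail_bound:
  assumes "\<bar>t\<bar> \<le> X"
  shows "\<bar>\<Sum>i=3..n. of_int (upper_coeff n w i) * t ^ i\<bar> \<le> real B * d / 8"
proof -
  have "\<bar>\<Sum>i=3..n. of_int (upper_coeff n w i) * t ^ i\<bar> \<le> real n * ((2 * real N) * X ^ n)"
  proof (rule abs_sum_monomials_le)
    show "\<bar>real_of_int (upper_coeff n w i)\<bar> \<le> 2 * real N" if "i \<in> {3..n}" for i
      using upper_coeff_ge_3[OF w that] by linarith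
  qed (use assms X in auto)
  thus ?thesis using N_bound[of 1] n by simp
qed

lemma tail_deriv_bound:
  assumes "\<bar>t\<bar> \<le> X"
  shows "\<bar>\<Sum>i=3..n. real i * of_int (upper_coeff n w i) * t ^ (i - 1)\<bar> \<le> real B * d / 8"
proof -
  have "\<bar>\<Sum>i=3..n. real i * of_int (upper_coeff n w i) * t ^ (i - 1)\<bar>
      \<le> real n * ((real n * (2 * real N)) * X ^ n)"
  proof (rule abs_sum_monomials_le)
    show "\<bar>real i * real_of_int (upper_coeff n w i)\<bar> \<le> real n * (2 * real N)" if "i \<in> {3..n}" for i
    proof -
      have "\<bar>real_of_int (upper_coeff n w i)\<bar> \<le> 2 * real N"
        using upper_coeff_ge_3[OF w that] by linarith
      thus ?thesis using that unfolding abs_mult by (intro mult_mono) auto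
    qed
  qed (use assms X in auto)
  thus ?thesis using N_bound[of n] by simp
qed

lemma tail_deriv:
  "((\<lambda>t. \<Sum>i=3..n. of_int (upper_coeff n w i) * t ^ i) has_real_derivative
     (\<Sum>i=3..n. real i * of_int (upper_coeff n w i) * t ^ (i - 1))) (at t)"
  by (auto intro!: derivative_eq_intros sum.cong simp: mult_ac)

text \<open>The secant coefficients would give the value 0 at \<open>x\<close>; deviations of at
  most \<open>tol\<close> change it by less than \<open>B * d * r / 8\<close>. The derivative stays
  at least \<open>B * d / 4\<close> in absolute value, since \<open>c2 >= 2 * B\<close> and
  \<open>\<bar>x - y\<bar> >= d\<close> outweigh all errors.\<close>

lemma family_poly_root_near:
  assumes u: "\<bar>of_int (2 * u) + secant_slope n w x y\<bar> \<le> tol"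
    and v: "\<bar>of_int (4 * v + 2) + secant_const n w x y\<bar> \<le> tol"
  shows "\<exists>z. \<bar>z - x\<bar> < r \<and> poly (map_poly of_int (family_poly n w u v)) z = 0"
  unfolding poly_family_poly[OF n]
proof (rule zero_near_perturbed_quadratic[where X = X and y = y and \<tau> = "real B * d / 8"
      and E = tol and D = "real B * d / 4"])
  let ?c2 = "real_of_int (upper_coeff n w 2)"
  have c2: "2 * real B \<le> ?c2" using upper_coeff_2[OF w] by linarith
  hence c2_pos: "?c2 > 0" using B by linarith
  show "x \<noteq> y" "?c2 \<noteq> 0" using d xy c2_pos by auto
  show "{x - r..x + r} \<subseteq> {- X..X}" "y \<in> {-X..X}" using x y r d by auto
  show "\<bar>of_int (2 * u) + ?c2 * (x + y)
      + ((\<Sum>i=3..n. of_int (upper_coeff n w i) * y ^ i) - (\<Sum>i=3..n. of_int (upper_coeff n w i) * x ^ i)) / (y - x)\<bar> \<le> tol"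
    using u by (simp add: secant_slope_def Let_def algebra_simps)
  have "2 * real B * d \<le> ?c2 * d" using c2 d by (intro mult_right_mono) auto
  moreover have "?c2 * r \<le> ?c2 * (d / 8)" using c2_pos r by (intro mult_left_mono) auto
  moreover have "?c2 * d \<le> ?c2 * \<bar>x - y\<bar>" using c2_pos xy by (intro mult_left_mono) auto
  moreover have "0 \<le> real B * d" using d by simp
  ultimately have "real B * d / 4 + 2 * (?c2 * r) + 2 * (real B * d / 8) + tol \<le> ?c2 * \<bar>x - y\<bar>"
    using tol_le by (simp add: algebra_simps)
  thus "real B * d / 4 + 2 * \<bar>?c2\<bar> * r + 2 * (real B * d / 8) + tol \<le> \<bar>?c2\<bar> * \<bar>x - y\<bar>"
    using c2_pos by (simp add: mult_ac)
  define e1 e0 where "e1 = of_int (2 * u) + secant_slope n w x y"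
    and "e0 = of_int (4 * v + 2) + secant_const n w x y"
  have "?c2 * x\<^sup>2 + (\<Sum>i=3..n. of_int (upper_coeff n w i) * x ^ i) + of_int (2 * u) * x + of_int (4 * v + 2)
      = e1 * x + e0"
    by (simp add: e1_def e0_def secant_const_def algebra_simps)
  also have "\<bar>e1 * x + e0\<bar> \<le> tol * \<bar>x\<bar> + tol * 1"
    using u v by (intro order_trans[OF abs_triangle_ineq] add_mono)
      (auto simp: abs_mult e1_def e0_def intro!: mult_right_mono)
  also have "\<dots> = tol * (\<bar>x\<bar> + 1)" by (simp add: algebra_simps)
  also have "\<dots> < tol * (1 + X)" using tol_pos x by (intro mult_strict_left_mono) auto
  also have "\<dots> \<le> real B * d / 4 * r" unfolding tol_X using d r B by simp
  finally show "\<bar>?c2 * x\<^sup>2 + (\<Sum>i=3..n. of_int (upper_coeff n w i) * x ^ i) + of_int (2 * u) * x + of_int (4 * v + 2)\<bar>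
      < real B * d / 4 * r" .
qed (use r tail_deriv tail_deriv_bound in auto)

text \<open>The difference quotient of the tail is a value of its derivative, so no division by the
  gap between \<open>x\<close> and \<open>y\<close> enters. Slope and constant are then at most
  \<open>9 * B * X\<close> and \<open>14 * B * X^2\<close>, and \<open>tol\<close> is at most
  \<open>B\<close>.\<close>

lemma family_coeff_bound:
  assumes u: "\<bar>of_int (2 * u) + secant_slope n w x y\<bar> \<le> tol"
    and v: "\<bar>of_int (4 * v + 2) + secant_const n w x y\<bar> \<le> tol"
    and i: "i \<le> n"
  shows "of_int \<bar>family_coeff n w u v i\<bar> \<le> 20 * X\<^sup>2 * real B"
proof -
  let ?c2 = "real_of_int (upper_coeff n w 2)"
  let ?T = "\<lambda>t. \<Sum>i=3..n. of_int (upper_coeff n w i) * t ^ i :: real"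
  have c2: "0 \<le> ?c2" "?c2 \<le> 4 * real B" using upper_coeff_2[OF w] by linarith+
  have BX: "real B \<le> real B * X" "real B * X \<le> real B * X\<^sup>2"
    using X B by (auto simp: power2_eq_square)
  have Bd: "real B * d \<le> real B" using d B by simp
  have tol: "tol \<le> real B" using tol_le Bd B by linarith
  have "\<exists>\<xi>\<in>{-X..X}. (?T y - ?T x) / (y - x) = (\<Sum>i=3..n. real i * of_int (upper_coeff n w i) * \<xi> ^ (i - 1))"
    using x y xy d by (intro MVT_slope tail_deriv) auto
  then obtain \<xi> where \<xi>: "\<xi> \<in> {-X..X}" "(?T y - ?T x) / (y - x) = (\<Sum>i=3..n. real i * of_int (upper_coeff n w i) * \<xi> ^ (i - 1))"
    by blast
  have quot: "\<bar>(?T y - ?T x) / (y - x)\<bar> \<le> real B"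
  proof -
    have "\<bar>(?T y - ?T x) / (y - x)\<bar> \<le> real B * d / 8"
      unfolding \<xi>(2) by (rule tail_deriv_bound) (use \<xi>(1) in auto)
    thus ?thesis using Bd B by linarith
  qed
  have "\<bar>?c2 * (x + y)\<bar> \<le> (4 * real B) * (2 * X)"
    unfolding abs_mult using c2 x y by (intro mult_mono) auto
  hence slope: "\<bar>secant_slope n w x y\<bar> \<le> 9 * (real B * X)"
    using quot BX unfolding secant_slope_def Let_def by linarith
  have "\<bar>secant_slope n w x y * x\<bar> \<le> 9 * (real B * X) * X"
    unfolding abs_mult using slope x X by (intro mult_mono) auto
  moreover have "\<bar>?c2 * x\<^sup>2\<bar> \<le> (4 * real B) * X\<^sup>2"
    unfolding abs_mult using c2 x by (intro mult_mono) (auto simp: abs_le_square_iff[symmetric])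
  moreover have "\<bar>?T x\<bar> \<le> real B" using tail_bound[of x] x Bd B by linarith
  ultimately have const: "\<bar>secant_const n w x y\<bar> \<le> 14 * (real B * X\<^sup>2)"
    using BX unfolding secant_const_def by (simp add: power2_eq_square)
  consider "i = 0" | "i = 1" | "i = 2" | "i \<in> {3..n}" using i by fastforce
  hence "of_int \<bar>family_coeff n w u v i\<bar> \<le> 20 * (real B * X\<^sup>2)"
  proof cases
    case 1
    have "\<bar>real_of_int (4 * v + 2)\<bar> \<le> 20 * (real B * X\<^sup>2)" using const v tol BX by linarith
    thus ?thesis using 1 by (simp add: family_coeff_def)
  next
    case 2
    have "\<bar>real_of_int (2 * u)\<bar> \<le> 20 * (real B * X\<^sup>2)" using slope u tol BX by linarith
    thus ?thesis using 2 by (simp add: family_coeff_def)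
  next
    case 3
    have "\<bar>?c2\<bar> \<le> 20 * (real B * X\<^sup>2)" using c2 BX by linarith
    thus ?thesis using 3 by (simp add: family_coeff_def)
  next
    case 4
    have "\<bar>upper_coeff n w i\<bar> \<le> int B" using upper_coeff_ge_3[OF w 4] N_le_B by linarith
    hence "\<bar>real_of_int (upper_coeff n w i)\<bar> \<le> 20 * (real B * X\<^sup>2)" using BX by linarith
    thus ?thesis using 4 by (simp add: family_coeff_def)
  qed
  thus ?thesis by (simp add: mult_ac)
qed

end

end

text \<open>The ceiling overshoots by less than 1, which the excluded upper end of the window
  absorbs.\<close>

lemma ceiling_window:
  fixes c k :: real
  assumes "k > 0" "u \<in> {\<lceil>c / k\<rceil>..<\<lceil>c / k\<rceil> + int m}"
  shows "\<bar>k * of_int u - c\<bar> \<le> k * real m"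
proof -
  have "c / k \<le> of_int u" "of_int u \<le> c / k + real m"
    using assms(2) by (auto simp: ceiling_le_iff) linarith
  thus ?thesis using assms(1) by (auto simp: field_simps abs_le_iff)
qed

context box_family
begin

text \<open>Every centre, weight and sieved pair yields a polynomial with a zero near each
  coordinate of the centre, hence a point. The map is injective: the boxes are disjoint, so the
  point determines the centre; it determines its minimal polynomial up to sign, and positive leading
  coefficients fix the sign.\<close>

lemma card_algebraic_points_near_ge:
  fixes Xs :: "real set" and f :: "real \<Rightarrow> real" and m :: nat
  assumes Xs: "finite Xs"
    and sep: "\<And>x x'. x \<in> Xs \<Longrightarrow> x' \<in> Xs \<Longrightarrow> x \<noteq> x' \<Longrightarrow> 2 * r \<le> \<bar>x - x'\<bar>"
    and bx: "\<And>x. x \<in> Xs \<Longrightarrow> \<bar>x\<bar> + 1 \<le> X" and bf: "\<And>x. x \<in> Xs \<Longrightarrow> \<bar>f x\<bar> + 1 \<le> X"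
    and gap: "\<And>x. x \<in> Xs \<Longrightarrow> d \<le> \<bar>x - f x\<bar>"
    and m: "4 * real m \<le> tol" and log: "12 * log 2 (4 * real B) \<le> real m"
    and Q: "20 * X\<^sup>2 * real B \<le> Q"
  shows "real (card Xs) * real (card weights) * ((real m)\<^sup>2 / 4)
    \<le> real (card (algebraic_points n Q \<inter> {(z1, z2). \<exists>x\<in>Xs. \<bar>z1 - x\<bar> < r \<and> \<bar>z2 - f x\<bar> < r}))"
    (is "_ \<le> real (card ?A)")
proof -
  \<comment> \<open>The windows start where \<open>2 * u\<close> and \<open>4 * v + 2\<close> would
    equal the low coefficients of the polynomial vanishing at \<open>x\<close> and
    \<open>f x\<close>.\<close>
  define G where "G = (\<lambda>x w. {(u, v) \<in> {\<lceil>- secant_slope n w x (f x) / 2\<rceil>..<\<lceil>- secant_slope n w x (f x) / 2\<rceil> + int m}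
      \<times> {\<lceil>(- secant_const n w x (f x) - 2) / 4\<rceil>..<\<lceil>(- secant_const n w x (f x) - 2) / 4\<rceil> + int m}.
      \<forall>p. prime p \<longrightarrow> p dvd 2 * w n + 1 \<longrightarrow> p dvd u \<longrightarrow> \<not> p dvd 2 * v + 1})"
  define I where "I = (SIGMA x:Xs. SIGMA w:weights. G x w)"
  have finG: "finite (G x w)" for x w
    unfolding G_def
    by (rule finite_subset[OF _ finite_cartesian_product[OF finite_atLeastLessThan_int finite_atLeastLessThan_int]]) blast
  have cardG: "(real m)\<^sup>2 / 4 \<le> real (card (G x w))" if "w \<in> weights" for x w
    unfolding G_def
  proof (rule card_primitive_pairs_ge)
    \<comment> \<open>The leading coefficient is the dominant one if \<open>n = 2\<close> and
      belongs to the tail otherwise; \<open>4 * B\<close> bounds it in both cases.\<close>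
    have "n = 2 \<or> n \<in> {3..n}" using n by auto
    hence q: "0 \<le> upper_coeff n w n" "upper_coeff n w n \<le> 4 * int B"
      using upper_coeff_2[OF that] upper_coeff_ge_3[OF that, of n] N_le_B by auto
    moreover have q_eq: "upper_coeff n w n = 2 * w n + 1" by (simp add: upper_coeff_def)
    ultimately show "0 < 2 * w n + 1" by presburger
    hence "log 2 (of_int (2 * w n + 1)) \<le> log 2 (of_int (4 * int B))"
      using q(2) B unfolding q_eq
      by (subst log_le_cancel_iff) (auto simp del: of_int_add of_int_mult simp: of_int_le_iff)
    thus "12 * log 2 (of_int (2 * w n + 1)) \<le> real m" using log by simp
  qed simp
  have near: "\<bar>of_int (2 * u) + secant_slope n w x (f x)\<bar> \<le> tol"
    "\<bar>of_int (4 * v + 2) + secant_const n w x (f x)\<bar> \<le> tol" if "(u, v) \<in> G x w" for x w u v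
  proof -
    have "\<bar>2 * of_int u - (- secant_slope n w x (f x))\<bar> \<le> 2 * real m"
      by (rule ceiling_window) (use that in \<open>auto simp: G_def\<close>)
    thus "\<bar>of_int (2 * u) + secant_slope n w x (f x)\<bar> \<le> tol" using m by simp
    have "\<bar>4 * of_int v - (- secant_const n w x (f x) - 2)\<bar> \<le> 4 * real m"
      by (rule ceiling_window) (use that in \<open>auto simp: G_def\<close>)
    thus "\<bar>of_int (4 * v + 2) + secant_const n w x (f x)\<bar> \<le> tol" using m by (simp add: algebra_simps)
  qed
  have "\<exists>\<alpha>. is_minimal_poly (family_poly n w u v) \<alpha> \<and> \<bar>fst \<alpha> - x\<bar> < r \<and> \<bar>snd \<alpha> - f x\<bar> < r"
    if x: "x \<in> Xs" and w: "w \<in> weights" and uv: "(u, v) \<in> G x w" for x w u v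
  proof -
    have ne: "x \<noteq> f x" using gap[OF x] d by auto
    obtain z1 where z1: "\<bar>z1 - x\<bar> < r" "poly (map_poly of_int (family_poly n w u v)) z1 = 0"
      using family_poly_root_near[OF w bx[OF x] bf[OF x] gap[OF x] near[OF uv]] by blast
    \<comment> \<open>The second zero comes from the same lemma with \<open>x\<close> and
      \<open>f x\<close> exchanged, by symmetry of the secant line.\<close>
    have gap': "d \<le> \<bar>f x - x\<bar>" using gap[OF x] by linarith
    obtain z2 where z2: "\<bar>z2 - f x\<bar> < r" "poly (map_poly of_int (family_poly n w u v)) z2 = 0"
      using family_poly_root_near[OF w bf[OF x] bx[OF x] gap'
          near(1)[OF uv, unfolded secant_slope_commute[of n w x]]
          near(2)[OF uv, unfolded secant_const_commute[OF ne]]] by blast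
    have "is_minimal_poly (family_poly n w u v) (z1, z2)"
      using uv z1 z2 by (intro is_minimal_poly_family_poly n) (auto simp: G_def vanishes_at_def)
    thus ?thesis using z1 z2 by (intro exI[of _ "(z1, z2)"]) auto
  qed
  hence "\<forall>i\<in>I. \<exists>\<alpha>. case i of (x, w, u, v) \<Rightarrow>
      is_minimal_poly (family_poly n w u v) \<alpha> \<and> \<bar>fst \<alpha> - x\<bar> < r \<and> \<bar>snd \<alpha> - f x\<bar> < r"
    by (auto simp: I_def)
  then obtain \<Phi> where "\<forall>i\<in>I. case i of (x, w, u, v) \<Rightarrow>
      is_minimal_poly (family_poly n w u v) (\<Phi> i) \<and> \<bar>fst (\<Phi> i) - x\<bar> < r \<and> \<bar>snd (\<Phi> i) - f x\<bar> < r"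
    by (rule bchoice[THEN exE])
  hence \<Phi>: "is_minimal_poly (family_poly n w u v) (\<Phi> (x, w, u, v))"
      "\<bar>fst (\<Phi> (x, w, u, v)) - x\<bar> < r" "\<bar>snd (\<Phi> (x, w, u, v)) - f x\<bar> < r"
    if "(x, w, u, v) \<in> I" for x w u v
    using that by auto
  have inj: "inj_on \<Phi> I"
  proof (rule inj_onI, clarify)
    fix x w u v x' w' u' v'
    assume i: "(x, w, u, v) \<in> I" and i': "(x', w', u', v') \<in> I"
      and eq: "\<Phi> (x, w, u, v) = \<Phi> (x', w', u', v')"
    have "\<bar>x - x'\<bar> < 2 * r" using \<Phi>(2)[OF i, unfolded eq] \<Phi>(2)[OF i'] by linarith
    hence x: "x = x'" using sep[of x x'] i i' by (fastforce simp: I_def)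
    have ww: "w \<in> weights" "w' \<in> weights" using i i' by (auto simp: I_def)
    have lead: "0 < coeff (family_poly n w u v) n" if "w \<in> weights" for w u v
    proof -
      have "n = 2 \<or> n \<in> {3..n}" using n by auto
      hence "0 \<le> upper_coeff n w n"
        using upper_coeff_2[OF that] upper_coeff_ge_3[OF that, of n] by auto
      hence "0 \<le> 2 * w n + 1" by (simp add: upper_coeff_def)
      hence "0 < 2 * w n + 1" by presburger
      thus ?thesis using n by (simp add: coeff_family_poly family_coeff_def upper_coeff_def)
    qed
    have "family_poly n w u v = family_poly n w' u' v' \<or> family_poly n w u v = - family_poly n w' u' v'"
      using minimal_poly_unique[OF \<Phi>(1)[OF i]] \<Phi>(1)[OF i'] eq by simp
    moreover have "family_poly n w u v \<noteq> - family_poly n w' u' v'"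
      using lead[OF ww(1), of u v] lead[OF ww(2), of u' v'] by (metis coeff_minus less_asym neg_0_less_iff_less)
    ultimately have *: "family_poly n w u v = family_poly n w' u' v'" by blast
    have "w = w'"
      using ww family_poly_inject(3)[OF n *] unfolding weights_def by (rule PiE_ext)
    thus "x = x' \<and> (w, u, v) = (w', u', v')"
      using x family_poly_inject(1,2)[OF n *] by simp
  qed
  have sub: "\<Phi> ` I \<subseteq> ?A"
  proof (rule image_subsetI, clarify)
    fix x w u v assume i: "(x, w, u, v) \<in> I"
    hence i': "x \<in> Xs" "w \<in> weights" "(u, v) \<in> G x w" by (auto simp: I_def)
    have "\<Phi> (x, w, u, v) \<in> algebraic_points n Q"
    proof (rule algebraic_pointsI[OF \<Phi>(1)[OF i]])
      fix j assume "j \<le> degree (family_poly n w u v)"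
      hence "j \<le> n" by (simp add: degree_family_poly n)
      thus "of_int \<bar>coeff (family_poly n w u v) j\<bar> \<le> Q"
        using family_coeff_bound[OF i'(2) bx bf gap near[OF i'(3)], of j] i'(1) Q
        by (simp add: coeff_family_poly)
    qed (simp add: degree_family_poly n)
    thus "\<Phi> (x, w, u, v) \<in> ?A"
      using \<Phi>(2,3)[OF i] i'(1) by (auto simp: case_prod_beta)
  qed
  have "real (card Xs) * real (card weights) * ((real m)\<^sup>2 / 4) = (\<Sum>x\<in>Xs. \<Sum>w\<in>weights. (real m)\<^sup>2 / 4)"
    by simp
  also have "\<dots> \<le> (\<Sum>x\<in>Xs. \<Sum>w\<in>weights. real (card (G x w)))"
    by (intro sum_mono cardG)
  also have "\<dots> = real (card I)"
    using Xs finite_weights finG by (simp add: I_def)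
  also have "card I = card (\<Phi> ` I)" by (rule card_image[OF inj, symmetric])
  also have "real (card (\<Phi> ` I)) \<le> real (card ?A)"
    using sub by (intro of_nat_mono card_mono finite_Int disjI1 finite_algebraic_points)
  finally show ?thesis .
qed

end

section \<open>Choice of the interval and growth estimates\<close>

text \<open>Some interior point is not fixed by \<open>f\<close>, and by continuity
  \<open>\<bar>x - f x\<bar>\<close> keeps half its value nearby. The interval has half-width
  \<open>2 * \<delta>\<close> so that boxes centred within \<delta> of \<open>x0\<close> still
  fit.\<close>

lemma ex_interval_off_diagonal:
  fixes f :: "real \<Rightarrow> real"
  assumes "a < b" and cont: "continuous_on {a..b} f" and fin: "finite {x \<in> {a..b}. f x = x}"
  obtains x0 \<delta> d where "\<delta> > 0" "0 < d" "d \<le> 1" "{x0 - 2 * \<delta>..x0 + 2 * \<delta>} \<subseteq> {a..b}"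
    "\<And>x. x \<in> {x0 - 2 * \<delta>..x0 + 2 * \<delta>} \<Longrightarrow> d \<le> \<bar>x - f x\<bar>"
proof -
  have "infinite ({a<..<b} - {x \<in> {a..b}. f x = x})"
    using assms by (intro Diff_infinite_finite) (auto simp: infinite_Ioo)
  then obtain x0 where "x0 \<in> {a<..<b} - {x \<in> {a..b}. f x = x}"
    using infinite_imp_nonempty by blast
  hence x0: "a < x0" "x0 < b" "f x0 \<noteq> x0" by auto
  define e where "e = \<bar>x0 - f x0\<bar>"
  have e: "e > 0" using x0 by (simp add: e_def)
  have cont': "continuous_on {a..b} (\<lambda>x. \<bar>x - f x\<bar>)" by (intro continuous_intros cont)
  have "x0 \<in> {a..b}" "e / 2 > 0" using x0 e by auto
  then obtain \<eta> where \<eta>: "\<eta> > 0"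
    "\<And>x. x \<in> {a..b} \<Longrightarrow> dist x x0 < \<eta> \<Longrightarrow> dist \<bar>x - f x\<bar> \<bar>x0 - f x0\<bar> < e / 2"
    using continuous_on_iff[THEN iffD1, OF cont'] by blast
  define \<delta> where "\<delta> = min (\<eta> / 3) (min ((x0 - a) / 2) ((b - x0) / 2))"
  have \<delta>: "\<delta> > 0" "2 * \<delta> < \<eta>" "2 * \<delta> \<le> x0 - a" "2 * \<delta> \<le> b - x0"
    using \<eta>(1) x0 unfolding \<delta>_def by (auto simp: min_def)
  show thesis
  proof (rule that[of \<delta> "min 1 (e / 2)" x0])
    fix x assume x: "x \<in> {x0 - 2 * \<delta>..x0 + 2 * \<delta>}"
    have "x \<in> {a..b}" "dist x x0 < \<eta>" using x \<delta> by (auto simp: dist_real_def abs_less_iff)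
    from \<eta>(2)[OF this] show "min 1 (e / 2) \<le> \<bar>x - f x\<bar>"
      using e unfolding dist_real_def e_def[symmetric] by linarith
  qed (use \<delta> e in auto)
qed

lemma nat_floor_ge_half:
  fixes t :: real
  assumes "t \<ge> 2"
  shows "t / 2 \<le> real (nat \<lfloor>t\<rfloor>)" "real (nat \<lfloor>t\<rfloor>) \<le> t"
  using assms by linarith+

lemma eventually_le_powr:
  fixes s C c :: real
  assumes "s > 0" "c > 0"
  shows "eventually (\<lambda>Q. C \<le> c * Q powr s) at_top"
proof -
  have "filterlim (\<lambda>Q. c * Q powr s) at_top at_top" using assms by real_asymp
  thus ?thesis by (simp add: filterlim_at_top)
qed

text \<open>The constants 12 and 4 are those of the sieve condition for leading coefficients up to
  \<open>4 * B\<close>.\<close>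

lemma eventually_log_le_powr:
  fixes s c :: real
  assumes "s > 0" "c > 0"
  shows "eventually (\<lambda>Q. 12 * log 2 (4 * Q) \<le> c * Q powr s) at_top"
proof -
  have "((\<lambda>Q. 12 * log 2 (4 * Q) / (c * Q powr s)) \<longlongrightarrow> 0) at_top"
    using assms by real_asymp
  hence "eventually (\<lambda>Q. 12 * log 2 (4 * Q) / (c * Q powr s) < 1) at_top"
    by (rule order_tendstoD) simp
  with eventually_gt_at_top[of 0] show ?thesis
    by eventually_elim (use assms in \<open>simp add: divide_simps\<close>)
qed

text \<open>"Sufficiently large" is expressed by a threshold \<open>C3\<close>. The constant
  \<open>c6\<close> is chosen before \<open>l\<close>, and \<open>Q0\<close> before
  \<open>c3\<close>.\<close>

theorem theorem3:
  fixes n :: nat and a b c5 :: real and f f' :: "real \<Rightarrow> real"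
  assumes "n \<ge> 2" and "a < b"
    and "\<And>x. x \<in> {a..b} \<Longrightarrow> (f has_real_derivative f' x) (at x within {a..b})"
    and "continuous_on {a..b} f'"
    and "bdd_above ((\<lambda>x. \<bar>f' x\<bar>) ` {a..b})"
    and "c5 = (SUP x\<in>{a..b}. \<bar>f' x\<bar>)"
    and "finite {x \<in> {a..b}. f x = x}"
  shows "\<exists>C3>0. \<exists>c6>0. \<forall>l. 0 < l \<and> l < 3/4 \<longrightarrow>
           (\<exists>Q0>0. \<forall>c3\<ge>C3. \<forall>Q>Q0.
              real (card (algebraic_points n Q \<inter> strip {a..b} f c5 c3 Q l))
                \<ge> c6 * Q powr (real n + 1 - l))"
proof -
  have c5: "\<bar>f' x\<bar> \<le> c5" if "x \<in> {a..b}" for x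
    unfolding assms(6) using that assms(5) by (intro cSUP_upper) auto
  have "a \<in> {a..b}" using assms(2) by simp
  hence c5_nonneg: "c5 \<ge> 0" using c5[of a] by linarith
  have lip: "\<bar>f x - f z\<bar> \<le> c5 * \<bar>x - z\<bar>" if "x \<in> {a..b}" "z \<in> {a..b}" for x z
    using field_differentiable_bound[of "{a..b}" f f' c5 x z] assms(3) c5 that by auto
  have cont: "continuous_on {a..b} f"
    using assms(3) by (rule DERIV_continuous_on)
  obtain x0 \<delta> d where \<delta>: "\<delta> > 0" and d: "0 < d" "d \<le> 1"
    and J0: "{x0 - 2 * \<delta>..x0 + 2 * \<delta>} \<subseteq> {a..b}"
    and gap: "\<And>x. x \<in> {x0 - 2 * \<delta>..x0 + 2 * \<delta>} \<Longrightarrow> d \<le> \<bar>x - f x\<bar>"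
    by (rule ex_interval_off_diagonal[OF assms(2) cont assms(7)], rule that)
  obtain M where "\<forall>y\<in>f ` {a..b}. norm y \<le> M"
    using compact_imp_bounded[OF compact_continuous_image[OF cont compact_Icc]]
    unfolding bounded_iff by blast
  hence M: "\<And>x. x \<in> {a..b} \<Longrightarrow> \<bar>f x\<bar> \<le> M" by simp
  define X where "X = 1 + \<bar>a\<bar> + \<bar>b\<bar> + \<bar>M\<bar>"
  have X: "X \<ge> 1" by (simp add: X_def)
  have bx: "\<bar>x\<bar> + 1 \<le> X" "\<bar>f x\<bar> + 1 \<le> X" if "x \<in> {a..b}" for x
    using that M[OF that] by (auto simp: X_def abs_le_iff)
  \<comment> \<open>With \<open>B\<close> about \<open>\<kappa> * Q\<close> the coefficients stay
    below \<open>Q\<close>; \<gamma> is the largest ratio \<open>N / B\<close> allowed in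
    \<open>box_family\<close>; \<mu> makes \<open>4 * (\<mu> * B * r)\<close> equal to
    \<open>tol\<close>.\<close>
  define \<kappa> where "\<kappa> = 1 / (20 * X\<^sup>2)"
  define \<gamma> where "\<gamma> = d / (16 * (real n)\<^sup>2 * X ^ n)"
  define \<mu> where "\<mu> = d / (32 * (1 + X))"
  have pos: "\<kappa> > 0" "\<gamma> > 0" "\<mu> > 0" using X d assms(1) by (simp_all add: \<kappa>_def \<gamma>_def \<mu>_def)
  have "1 \<le> X\<^sup>2" using X by (simp add: one_le_power)
  hence \<kappa>_le: "\<kappa> \<le> 1" by (simp add: \<kappa>_def divide_simps)
  \<comment> \<open>The factors come from the numbers of boxes, of weights and of pairs; every
    rounding down costs a factor of at most 2.\<close>
  define c6 where "c6 = (\<delta> / 4) * ((\<kappa> / 2) * (\<gamma> * \<kappa> / 4) ^ (n - 2)) * ((\<mu> * \<kappa> / 4)\<^sup>2 / 4)"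
  have c6: "c6 > 0" using pos \<delta> by (simp add: c6_def)
  have main: "\<exists>Q0>0. \<forall>c3\<ge>3. \<forall>Q>Q0.
      real (card (algebraic_points n Q \<inter> strip {a..b} f c5 c3 Q l)) \<ge> c6 * Q powr (real n + 1 - l)"
    if l: "0 < l" "l < 3/4" for l
  proof -
    \<comment> \<open>The bounds by 2 let the roundings defining \<open>B\<close>, \<open>N\<close>,
      \<open>m\<close> and \<open>K\<close> lose at most half. The others are the sieve condition
      and \<open>r <= d / 8\<close>.\<close>
    have "eventually (\<lambda>Q. 2 \<le> \<kappa> * Q powr 1 \<and> 2 \<le> \<gamma> * \<kappa> / 2 * Q powr 1
        \<and> 2 \<le> \<mu> * \<kappa> / 2 * Q powr (1 - l) \<and> 12 * log 2 (4 * Q) \<le> \<mu> * \<kappa> / 4 * Q powr (1 - l)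
        \<and> 2 \<le> \<delta> / 2 * Q powr l \<and> 1 \<le> d / 8 * Q powr l) at_top"
      using l pos \<delta> d by (intro eventually_conj eventually_le_powr eventually_log_le_powr) auto
    then obtain Q1 where Q1: "\<And>Q. Q \<ge> Q1 \<Longrightarrow> 2 \<le> \<kappa> * Q powr 1 \<and> 2 \<le> \<gamma> * \<kappa> / 2 * Q powr 1
        \<and> 2 \<le> \<mu> * \<kappa> / 2 * Q powr (1 - l) \<and> 12 * log 2 (4 * Q) \<le> \<mu> * \<kappa> / 4 * Q powr (1 - l)
        \<and> 2 \<le> \<delta> / 2 * Q powr l \<and> 1 \<le> d / 8 * Q powr l"
      by (auto simp: eventually_at_top_linorder)
    have "real (card (algebraic_points n Q \<inter> strip {a..b} f c5 c3 Q l)) \<ge> c6 * Q powr (real n + 1 - l)"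
      if c3: "c3 \<ge> 3" and Q: "Q > max Q1 1" for c3 Q
    proof -
      define r where "r = Q powr (- l)"
      have Q_pos: "Q > 0" "Q \<ge> 1" using Q by auto
      have r: "r > 0" using Q_pos by (simp add: r_def)
      have Qr: "Q powr (1 - l) = Q * r" "Q powr l = 1 / r"
        using Q_pos by (simp_all add: r_def powr_diff powr_minus field_simps)
      have large: "2 \<le> \<kappa> * Q" "2 \<le> \<gamma> * \<kappa> / 2 * Q" "2 \<le> \<mu> * \<kappa> / 2 * (Q * r)"
        "12 * log 2 (4 * Q) \<le> \<mu> * \<kappa> / 4 * (Q * r)" "2 \<le> \<delta> / 2 / r" "r \<le> d / 8"
        using Q1[of Q] Q r unfolding Qr by (auto simp: field_simps)
      define B N m K where "B = nat \<lfloor>\<kappa> * Q\<rfloor>" and "N = nat \<lfloor>\<gamma> * real B\<rfloor>"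
        and "m = nat \<lfloor>\<mu> * (real B * r)\<rfloor>" and "K = nat \<lfloor>\<delta> / 2 / r\<rfloor>"
      have B_bounds: "\<kappa> * Q / 2 \<le> real B" "real B \<le> \<kappa> * Q"
        unfolding B_def using nat_floor_ge_half[OF large(1)] by auto
      have "\<gamma> * (\<kappa> * Q / 2) \<le> \<gamma> * real B" using B_bounds pos by (intro mult_left_mono) auto
      hence \<gamma>B: "\<gamma> * \<kappa> / 2 * Q \<le> \<gamma> * real B" by simp
      hence "2 \<le> \<gamma> * real B" using large(2) by linarith
      from nat_floor_ge_half[OF this] \<gamma>B have N_bounds: "\<gamma> * \<kappa> / 4 * Q \<le> real N" "real N \<le> \<gamma> * real B"
        unfolding N_def by linarith+
      have "\<mu> * (\<kappa> * Q / 2 * r) \<le> \<mu> * (real B * r)"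
        using B_bounds pos r by (intro mult_left_mono mult_right_mono) auto
      hence \<mu>B: "\<mu> * \<kappa> / 2 * (Q * r) \<le> \<mu> * (real B * r)" by simp
      hence "2 \<le> \<mu> * (real B * r)" using large(3) by linarith
      from nat_floor_ge_half[OF this] \<mu>B
      have m: "\<mu> * \<kappa> / 4 * (Q * r) \<le> real m" "real m \<le> \<mu> * (real B * r)"
        unfolding m_def by linarith+
      have K: "\<delta> / 4 / r \<le> real K" "real K \<le> \<delta> / 2 / r"
        unfolding K_def using nat_floor_ge_half[OF large(5)] by auto
      interpret box_family n B N X d r
      proof
        show "1 \<le> B" using B_bounds(1) large(1) by linarith
        have "16 * (real n)\<^sup>2 * X ^ n * real N \<le> 16 * (real n)\<^sup>2 * X ^ n * (\<gamma> * real B)"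
          using N_bounds(2) X by (intro mult_left_mono) auto
        also have "\<dots> = real B * d" using X assms(1) by (simp add: \<gamma>_def)
        finally show "16 * (real n)\<^sup>2 * X ^ n * real N \<le> real B * d" .
      qed (use assms(1) X d r large(6) in auto)
      \<comment> \<open>Spacing \<open>2 * r\<close> makes the boxes disjoint, and
        \<open>K <= \<delta> / (2 * r)\<close> keeps the centres within \<delta> of
        \<open>x0\<close>.\<close>
      define Xs where "Xs = (\<lambda>k. x0 + 2 * r * real k) ` {..<K}"
      have "inj_on (\<lambda>k. x0 + 2 * r * real k) {..<K}" using r by (auto simp: inj_on_def)
      hence cardXs: "card Xs = K" by (simp add: Xs_def card_image)
      have XsJ: "x \<in> {x0..x0 + \<delta>}" if x: "x \<in> Xs" for x
      proof -
        obtain k where k: "k < K" "x = x0 + 2 * r * real k" using x by (auto simp: Xs_def)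
        have "real k * r \<le> real K * r" using k r by (intro mult_right_mono) auto
        also have "real K * r \<le> \<delta> / 2" using K(2) r by (simp add: field_simps)
        finally show ?thesis using k(2) r by (simp add: mult_ac)
      qed
      have XsJ0: "x \<in> {x0 - 2 * \<delta>..x0 + 2 * \<delta>}" if "x \<in> Xs" for x
        using XsJ[OF that] \<delta> by auto
      have Xsab: "x \<in> {a..b}" if "x \<in> Xs" for x
        using XsJ0[OF that] J0 by blast
      have sep: "2 * r \<le> \<bar>x - x'\<bar>" if xx: "x \<in> Xs" "x' \<in> Xs" "x \<noteq> x'" for x x'
      proof -
        obtain k k' where k: "x = x0 + 2 * r * real k" "x' = x0 + 2 * r * real k'"
          using xx by (auto simp: Xs_def)
        hence "k \<noteq> k'" using xx by auto
        hence "1 \<le> \<bar>real k - real k'\<bar>" by linarith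
        hence "2 * r * 1 \<le> 2 * r * \<bar>real k - real k'\<bar>" using r by (intro mult_left_mono) auto
        also have "\<dots> = \<bar>2 * r * (real k - real k')\<bar>" using r by (simp add: abs_mult)
        also have "\<dots> = \<bar>x - x'\<bar>" unfolding k by (simp add: algebra_simps)
        finally show ?thesis by simp
      qed
      have \<delta>r: "r \<le> \<delta>" using large(5) r \<delta> by (simp add: field_simps)
      let ?S = "{(z1, z2). \<exists>x\<in>Xs. \<bar>z1 - x\<bar> < r \<and> \<bar>z2 - f x\<bar> < r}"
      have "real (card Xs) * real (card weights) * ((real m)\<^sup>2 / 4)
          \<le> real (card (algebraic_points n Q \<inter> ?S))"
      proof (rule card_algebraic_points_near_ge)
        show "4 * real m \<le> tol"
          using m(2) X by (simp add: tol_def \<mu>_def field_simps)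
        have "log 2 (4 * real B) \<le> log 2 (4 * Q)"
        proof (subst log_le_cancel_iff)
          have "\<kappa> * Q \<le> 1 * Q" using \<kappa>_le Q_pos by (intro mult_right_mono) auto
          thus "4 * real B \<le> 4 * Q" using B_bounds(2) by linarith
          show "0 < 4 * real B" using B_bounds(1) large(1) by linarith
        qed (use Q_pos in auto)
        thus "12 * log 2 (4 * real B) \<le> real m" using large(4) m(1) by linarith
        have "20 * X\<^sup>2 * real B \<le> 20 * X\<^sup>2 * (\<kappa> * Q)" using B_bounds(2) by (intro mult_left_mono) auto
        also have "\<dots> = Q" using X by (simp add: \<kappa>_def)
        finally show "20 * X\<^sup>2 * real B \<le> Q" .
      qed (use sep bx Xsab gap XsJ0 in \<open>auto simp: Xs_def\<close>)
      also have "\<dots> \<le> real (card (algebraic_points n Q \<inter> strip {a..b} f c5 c3 Q l))"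
      proof (intro of_nat_mono card_mono finite_Int disjI1 finite_algebraic_points Int_mono order_refl)
        show "?S \<subseteq> strip {a..b} f c5 c3 Q l"
        proof clarify
          fix z1 z2 x assume x: "x \<in> Xs" and z: "\<bar>z1 - x\<bar> < r" "\<bar>z2 - f x\<bar> < r"
          have z1: "z1 \<in> {a..b}"
          proof -
            have "z1 \<in> {x0 - 2 * \<delta>..x0 + 2 * \<delta>}" using XsJ[OF x] z(1) \<delta>r by auto
            thus ?thesis using J0 by blast
          qed
          \<comment> \<open>The strip compares \<open>z2\<close> with \<open>f z1\<close>, the box
            with \<open>f x\<close>. The Lipschitz bound makes up the difference, and the total
            \<open>(1 + c5) * r\<close> fits into the strip once \<open>c3 >= 3\<close>.\<close>
          have "\<bar>f x - f z1\<bar> \<le> c5 * \<bar>x - z1\<bar>" by (rule lip[OF Xsab[OF x] z1])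
          also have "\<dots> \<le> c5 * r" using z c5_nonneg by (intro mult_left_mono) auto
          finally have "\<bar>z2 - f z1\<bar> < r + c5 * r" using z(2) by linarith
          also have "\<dots> = (1 + c5) * r" by (simp add: algebra_simps)
          also have "\<dots> \<le> ((1/2 + c5) * c3) * r"
          proof (rule mult_right_mono)
            have "1 + c5 \<le> (1/2 + c5) * 3" using c5_nonneg by simp
            also have "\<dots> \<le> (1/2 + c5) * c3" using c3 c5_nonneg by (intro mult_left_mono) auto
            finally show "1 + c5 \<le> (1/2 + c5) * c3" .
          qed (use r in auto)
          finally show "(z1, z2) \<in> strip {a..b} f c5 c3 Q l"
            using z1 by (simp add: strip_def r_def)
        qed
      qed
      finally have lower: "real K * (real B * real N ^ (n - 2)) * ((real m)\<^sup>2 / 4)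
          \<le> real (card (algebraic_points n Q \<inter> strip {a..b} f c5 c3 Q l))"
        by (simp add: cardXs card_weights)
      \<comment> \<open>The powers combine as
        \<open>(1 / r) * Q * Q^(n - 2) * (Q * r)^2 = Q^(n + 1) * r\<close>, with
        \<open>r = Q powr (- l)\<close>.\<close>
      have "c6 * Q powr (real n + 1 - l)
          = (\<delta> / 4 / r) * ((\<kappa> * Q / 2) * (\<gamma> * \<kappa> / 4 * Q) ^ (n - 2)) * ((\<mu> * \<kappa> / 4 * (Q * r))\<^sup>2 / 4)"
      proof -
        have "Q powr (real n + 1 - l) = Q powr (real (n + 1)) * Q powr (- l)"
          by (simp add: powr_add[symmetric] add.commute)
        also have "\<dots> = Q ^ (n + 1) * r" unfolding r_def powr_realpow[OF Q_pos(1)] ..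
        also have "n + 1 = (n - 2) + 3" using assms(1) by simp
        finally have "Q powr (real n + 1 - l) = Q ^ (n - 2) * Q ^ 3 * r" by (simp only: power_add)
        thus ?thesis
          using r unfolding c6_def power_mult_distrib[of "\<gamma> * \<kappa> / 4" Q]
          by (simp add: power2_eq_square power3_eq_cube field_simps del: power_divide)
      qed
      also have "\<dots> \<le> real K * (real B * real N ^ (n - 2)) * ((real m)\<^sup>2 / 4)"
        using K B_bounds N_bounds m pos \<delta> r Q_pos
        by (intro mult_mono divide_right_mono power_mono) auto
      finally show ?thesis using lower by linarith
    qed
    thus ?thesis by (intro exI[of _ "max Q1 1"]) auto
  qed
  show ?thesis by (intro exI[of _ 3] exI[of _ c6]) (use c6 main in auto)
qed

end
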